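(* For coprime positive integers $s$ and $t$, the number of doubled distinct $(s,t)$-core partitions is \[ |\mathcal{DD}_{(s,t)}|=\binom{\lfloor (s-1)/2 \rfloor + \lfloor (t-1)/2 \rfloor}{\lfloor (s-1)/2 \rfloor}, \] and the number of $(s,t)$-CSYDs is \[ |\mathcal{CS}_{(s,t)}|=\binom{\lfloor (s-1)/2\rfloor + \lfloor t/2\rfloor -1}{\lfloor (s-1)/2\rfloor} +\binom{\lfloor s/2\rfloor + \lfloor (t-1)/2\rfloor-1}{\lfloor (t-1)/2\rfloor}. \]
   Context: A strict partition $\lambda=(\lambda_1>\lambda_2>\cdots>\lambda_\ell)$ is a finite (possibly empty) strictly decreasing sequence of positive integers. Shifted diagrams: the shifted Young diagram $S(\lambda)$ has boxes $(i,j)$ (row $i$, column $j$) with $1\le i\le\ell$ and $i\le j\le i+\lambda_i-1$. The shifted hook length $h^*_{i,j}(\lambda)$ of a box $(i,j)$ is the number of boxes consisting of the box itself, the boxes to its right in row $i$, the boxes below it in column $j$, and all boxes of row $j+1$ of $S(\lambda)$ (if that row exists). $\lambda$ (or $S(\lambda)$) is an $s$-core shifted Young diagram, or $s$-CSYD, if no shifted hook length of $S(\lambda)$ is divisible by $s$. Doubled distinct partitions: for a strict partition $\lambda$, the doubled distinct partition $\lambda\lambda$ is the ordinary partition with Frobenius symbol $\begin{pmatrix}\lambda_1&\cdots&\lambda_\ell\\ \lambda_1-1&\cdots&\lambda_\ell-1\end{pmatrix}$ (the $i$th diagonal box has arm length $\lambda_i$ and leg length $\lambda_i-1$). It is a doubled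 distinct $s$-core if no hook length of its Young diagram is divisible by $s$. $\mathcal{DD}_{(s,t)}$ is the set of doubled distinct partitions $\lambda\lambda$ ($\lambda$ strict) that are both doubled distinct $s$-cores and doubled distinct $t$-cores. $\mathcal{CS}_{(s,t)}$ is the set of strict partitions that are both $s$-CSYDs and $t$-CSYDs. The empty partition is included in both sets.
   Formalization: The CSYD formula is stated except for s = t = 1, where it is false (there is one CSYD, but the formula is twice binom(-1,0)); binomials with negative upper argument are taken as 0, which the formula needs for {s,t} = {1,2}. *)

theory Defs
  imports Main
begin

text \<open>
  Partitions are lists of parts, largest part first. Boxes are pairs (row, column), both
  counted from 1, so that row \<open>i\<close> of the partition \<open>p\<close> has the part \<open>p ! (i - 1)\<close>.
\<close>

definition strict_partition :: "nat list \<Rightarrow> bool" where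
  "strict_partition l \<longleftrightarrow> sorted_wrt (>) l \<and> (\<forall>x \<in> set l. 0 < x)"

definition shifted_diagram :: "nat list \<Rightarrow> (nat \<times> nat) set" where
  "shifted_diagram l =
     {(i, j). 1 \<le> i \<and> i \<le> length l \<and> i \<le> j \<and> j \<le> i + l ! (i - 1) - 1}"

definition shifted_hook :: "nat list \<Rightarrow> nat \<Rightarrow> nat \<Rightarrow> (nat \<times> nat) set" where
  "shifted_hook l i j =
     {(i, j)}
     \<union> {(i, j') | j'. j < j' \<and> (i, j') \<in> shifted_diagram l}
     \<union> {(i', j) | i'. i < i' \<and> (i', j) \<in> shifted_diagram l}
     \<union> {(j + 1, j') | j'. (j + 1, j') \<in> shifted_diagram l}"

definition shifted_hook_length :: "nat list \<Rightarrow> nat \<Rightarrow> nat \<Rightarrow> nat" where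
  "shifted_hook_length l i j = card (shifted_hook l i j)"

definition csyd :: "nat \<Rightarrow> nat list \<Rightarrow> bool" where
  "csyd s l \<longleftrightarrow> strict_partition l \<and>
     (\<forall>(i, j) \<in> shifted_diagram l. \<not> s dvd shifted_hook_length l i j)"

definition CS :: "nat \<Rightarrow> nat \<Rightarrow> nat list set" where
  "CS s t = {l. csyd s l \<and> csyd t l}"

definition is_partition :: "nat list \<Rightarrow> bool" where
  "is_partition p \<longleftrightarrow> sorted_wrt (\<ge>) p \<and> (\<forall>x \<in> set p. 0 < x)"

definition young_diagram :: "nat list \<Rightarrow> (nat \<times> nat) set" where
  "young_diagram p = {(i, j). 1 \<le> i \<and> i \<le> length p \<and> 1 \<le> j \<and> j \<le> p ! (i - 1)}"

definition arm_length :: "nat list \<Rightarrow> nat \<Rightarrow> nat \<Rightarrow> nat" where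
  "arm_length p i j = card {j'. j < j' \<and> (i, j') \<in> young_diagram p}"

definition leg_length :: "nat list \<Rightarrow> nat \<Rightarrow> nat \<Rightarrow> nat" where
  "leg_length p i j = card {i'. i < i' \<and> (i', j) \<in> young_diagram p}"

definition hook_length :: "nat list \<Rightarrow> nat \<Rightarrow> nat \<Rightarrow> nat" where
  "hook_length p i j = arm_length p i j + leg_length p i j + 1"

definition core :: "nat \<Rightarrow> nat list \<Rightarrow> bool" where
  "core s p \<longleftrightarrow> is_partition p \<and>
     (\<forall>(i, j) \<in> young_diagram p. \<not> s dvd hook_length p i j)"

definition diagonal_length :: "nat list \<Rightarrow> nat" where
  "diagonal_length p = card {i. (i, i) \<in> young_diagram p}"

definition frobenius_symbol :: "nat list \<Rightarrow> nat list \<times> nat list" where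
  "frobenius_symbol p =
     (map (\<lambda>i. arm_length p i i) [1..<diagonal_length p + 1],
      map (\<lambda>i. leg_length p i i) [1..<diagonal_length p + 1])"

text \<open>\<open>is_double_of l p\<close> says that \<open>p\<close> is the doubled distinct partition of \<open>l\<close>.\<close>

definition is_double_of :: "nat list \<Rightarrow> nat list \<Rightarrow> bool" where
  "is_double_of l p \<longleftrightarrow> strict_partition l \<and> is_partition p \<and>
     frobenius_symbol p = (l, map (\<lambda>x. x - 1) l)"

definition doubled_distinct :: "nat list \<Rightarrow> bool" where
  "doubled_distinct p \<longleftrightarrow> (\<exists>l. is_double_of l p)"

definition DD :: "nat \<Rightarrow> nat \<Rightarrow> nat list set" where
  "DD s t = {p. doubled_distinct p \<and> core s p \<and> core t p}"

text \<open>
  Binomial coefficient with integer upper argument, equal to 0 when that argument is negative.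
  For \<open>s = 1\<close>, \<open>t = 2\<close> the upper argument -1 occurs over the lower argument 0; both truncated
  subtraction on \<open>nat\<close> and the generalised coefficient \<open>gchoose\<close> would give 1 there.
\<close>

definition int_binomial :: "int \<Rightarrow> nat \<Rightarrow> nat" where
  "int_binomial n k = (if n < 0 then 0 else nat n choose k)"

end

theory Submission
  imports Defs
begin

text \<open>
  A strict partition is determined by its set \<open>L\<close> of parts, and both kinds of core are read off from
  one set of integers, \<open>X = L \<union> {- n | n > 0, n \<notin> L}\<close>. It is the beta set of the doubled distinct
  partition: the integers \<open>p\<^sub>i - i\<close>, for all rows \<open>i\<close> including the empty ones
  (lemma \<open>beta_set_double\<close>). By construction \<open>0 \<notin> X\<close>, and for \<open>x \<noteq> 0\<close> exactly one of \<open>x\<close>, \<open>- x\<close> lies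
  in \<open>X\<close>. The hook lengths of the doubled partition are the differences \<open>x - y > 0\<close> with \<open>x \<in> X\<close> and
  \<open>y \<notin> X\<close>, so it is an \<open>s\<close>-core if and only if \<open>X\<close> is closed under subtraction of \<open>s\<close>.

  The doubled diagram consists of the shifted diagram, moved one column to the right, and its
  transpose. The shifted hook lengths are the ordinary hook lengths of the boxes in the moved copy;
  these are the differences \<open>x - y\<close> with \<open>- x < y\<close> (lemma \<open>csyd_iff\<close>). The reflection
  \<open>(x, y) \<mapsto> (- y, - x)\<close> preserves differences and carries the remaining pairs to such pairs, except for
  \<open>y = - x\<close>. So the two core conditions differ only in the differences \<open>2 x\<close>. For odd \<open>s\<close> they agree;
  for \<open>s = 2 m\<close> a doubled distinct \<open>s\<close>-core is an \<open>s\<close>-CSYD without the part \<open>m\<close>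
  (lemma \<open>closed_under_sub_iff_bar_core\<close>).

  To count, write every integer as \<open>t i - s k\<close>, which coprimality permits, uniquely up to
  \<open>(i, k) \<mapsto> (i + s, k + t)\<close>. Closure under \<open>s\<close> says that for fixed \<open>i\<close> the number \<open>t i - s k\<close> lies in
  \<open>X\<close> exactly for \<open>k \<ge> h i\<close>, and closure under \<open>t\<close> says that \<open>h\<close> is weakly increasing. Moreover
  \<open>h (i + s) = h i + t\<close>, and the reflection gives \<open>h 0 = 1\<close> and \<open>h i + h (- i) = 1\<close> when \<open>s\<close> does not
  divide \<open>i\<close>. Hence \<open>h i + h (s - i) = t + 1\<close> for \<open>0 < i < s\<close>, and \<open>h\<close> is determined by
  \<open>h 1 \<le> \<dots> \<le> h \<lfloor>(s - 1) / 2\<rfloor>\<close>, which can be any weakly increasing sequence with entries in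
  \<open>{1..\<lfloor>(t + 1) / 2\<rfloor>}\<close>. Counting these sequences gives the first formula.

  If both moduli are odd, CSYDs and doubled distinct cores have the same sets of parts, and the
  second formula is the first one split by Pascal's rule. Otherwise one modulus is even, by symmetry
  \<open>s = 2 m\<close>, and in addition to the simultaneous cores there are the CSYDs with the part \<open>m\<close>. Deleting \<open>m\<close> maps them bijectively to the simultaneous cores with
  \<open>m - t \<in> X\<close> (lemma \<open>half_in_bar_core\<close>). As \<open>m - t = t (m - 1) - s (t - 1) / 2\<close>, this condition is
  \<open>h (m - 1) \<le> (t - 1) / 2\<close>: the same sequences are counted again with the bound on the entries
  lowered by one, which gives the other summand.
\<close>

section \<open>Hook lengths and the beta set of a partition\<close>

definition row_length :: "nat list \<Rightarrow> nat \<Rightarrow> nat" where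
  "row_length p i = (if 1 \<le> i \<and> i \<le> length p then p ! (i - 1) else 0)"

definition col_length :: "nat list \<Rightarrow> nat \<Rightarrow> nat" where
  "col_length p j = card {i. (i, j) \<in> young_diagram p}"

text \<open>
  All rows count, the empty ones below the partition included: they contribute every sufficiently
  negative integer, so that the set does not depend on a chosen number of rows.
\<close>

definition beta_set :: "nat list \<Rightarrow> int set" where
  "beta_set p = {int (row_length p i) - int i | i. 1 \<le> i}"

text \<open>
  Rows, columns and the diagonal of a diagram are sets of this kind, which is how their cardinalities
  become membership tests.
\<close>

lemma finite_down_closed_eq_interval:
  fixes A :: "nat set"
  assumes fin: "finite A" and pos: "\<And>k. k \<in> A \<Longrightarrow> 1 \<le> k"
    and down: "\<And>k m. k \<in> A \<Longrightarrow> 1 \<le> m \<Longrightarrow> m \<le> k \<Longrightarrow> m \<in> A"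
  shows "A = {1..card A}"
proof (cases "A = {}")
  case False
  have "A = {1..Max A}"
  proof (intro equalityI subsetI)
    show "k \<in> {1..Max A}" if "k \<in> A" for k using that pos[OF that] Max_ge[OF fin that] by simp
    show "k \<in> A" if "k \<in> {1..Max A}" for k using that down[OF Max_in[OF fin False]] by simp
  qed
  then show ?thesis by (metis card_atLeastAtMost diff_Suc_1)
qed simp

lemma mem_young_diagram_iff:
  "(i, j) \<in> young_diagram p \<longleftrightarrow> 1 \<le> i \<and> 1 \<le> j \<and> j \<le> row_length p i"
  by (auto simp: young_diagram_def row_length_def)

lemma row_length_antimono:
  assumes "is_partition p" "1 \<le> i" "i \<le> k"
  shows "row_length p k \<le> row_length p i"
proof (cases "k \<le> length p \<and> i < k")
  case True
  then have "p ! (k - 1) \<le> p ! (i - 1)"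
    using assms unfolding is_partition_def sorted_wrt_iff_nth_less by auto
  then show ?thesis using True assms by (auto simp: row_length_def)
qed (use assms in \<open>auto simp: row_length_def\<close>)

lemma finite_column: "finite {i. (i, j) \<in> young_diagram p}"
  by (rule finite_subset[of _ "{..length p}"]) (auto simp: young_diagram_def)

text \<open>
  Both sides say that \<open>(i, j)\<close> is a box: conjugation of partitions as a Galois connection between row
  and column lengths.
\<close>

lemma le_row_length_iff_le_col_length:
  assumes "is_partition p" "1 \<le> i" "1 \<le> j"
  shows "j \<le> row_length p i \<longleftrightarrow> i \<le> col_length p j"
proof -
  have "{i. (i, j) \<in> young_diagram p} = {1..col_length p j}"
    unfolding col_length_def
  proof (rule finite_down_closed_eq_interval[OF finite_column])
    fix k m assume "k \<in> {i. (i, j) \<in> young_diagram p}" "1 \<le> m" "m \<le> k"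
    then show "m \<in> {i. (i, j) \<in> young_diagram p}"
      using row_length_antimono[OF assms(1), of m k] by (simp add: mem_young_diagram_iff)
  qed (simp add: mem_young_diagram_iff)
  then have "(i, j) \<in> young_diagram p \<longleftrightarrow> i \<in> {1..col_length p j}" by blast
  then show ?thesis using assms by (auto simp: mem_young_diagram_iff)
qed

lemma arm_length_eq:
  assumes "1 \<le> i"
  shows "arm_length p i j = row_length p i - j"
proof -
  have "{j'. j < j' \<and> (i, j') \<in> young_diagram p} = {j<..row_length p i}"
    using assms by (auto simp: mem_young_diagram_iff)
  then show ?thesis by (simp add: arm_length_def)
qed

lemma leg_length_eq:
  assumes "is_partition p" "1 \<le> j"
  shows "leg_length p i j = col_length p j - i"
proof -
  have "{i'. i < i' \<and> (i', j) \<in> young_diagram p} = {i<..col_length p j}"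
    using assms by (auto simp: mem_young_diagram_iff le_row_length_iff_le_col_length)
  then show ?thesis by (simp add: leg_length_def)
qed

text \<open>
  The labels of the columns, dual to those of the rows in the beta set. Reading the boundary of the
  diagram as a lattice path whose steps are numbered by consecutive integers, the vertical steps carry
  the elements of the beta set and the horizontal steps carry the gaps; so the gaps are the integers
  outside the beta set.
\<close>

definition gap :: "nat list \<Rightarrow> nat \<Rightarrow> int" where
  "gap p j = int j - 1 - int (col_length p j)"

lemma gap_less_beta_iff:
  assumes "is_partition p" "1 \<le> i" "1 \<le> j"
  shows "gap p j < int (row_length p i) - int i \<longleftrightarrow> (i, j) \<in> young_diagram p"
  using le_row_length_iff_le_col_length[OF assms] assms
  unfolding gap_def mem_young_diagram_iff by linarith

text \<open>
  A hook is the part of the boundary path between the vertical step that ends its row and the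
  horizontal step that ends its column.
\<close>

lemma hook_length_eq_beta_minus_gap:
  assumes "is_partition p" "(i, j) \<in> young_diagram p"
  shows "int (hook_length p i j) = (int (row_length p i) - int i) - gap p j"
proof -
  have ij: "1 \<le> i" "1 \<le> j" "j \<le> row_length p i"
    using assms(2) by (auto simp: mem_young_diagram_iff)
  moreover have "i \<le> col_length p j"
    using ij le_row_length_iff_le_col_length[OF assms(1)] by blast
  ultimately show ?thesis
    using assms(1) by (simp add: hook_length_def arm_length_eq leg_length_eq gap_def)
qed

lemma gap_notin_beta_set:
  assumes "is_partition p" "1 \<le> j"
  shows "gap p j \<notin> beta_set p"
proof
  assume "gap p j \<in> beta_set p"
  then obtain i where i: "1 \<le> i" "gap p j = int (row_length p i) - int i"
    by (auto simp: beta_set_def)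
  show False
    using i(2) le_row_length_iff_le_col_length[OF assms(1) i(1) assms(2)]
    unfolding gap_def by linarith
qed

text \<open>
  The column with label \<open>y\<close> has as many boxes as there are beta numbers above \<open>y\<close>. This number \<open>r\<close> of
  rows fixes the column index as \<open>y + r + 1\<close>; comparing with rows \<open>r\<close> and \<open>r + 1\<close> confirms it.
\<close>

lemma not_beta_is_gap:
  assumes p: "is_partition p" and y: "y \<notin> beta_set p"
  obtains j where "1 \<le> j" "gap p j = y"
proof -
  define A where "A = {i. 1 \<le> i \<and> y < int (row_length p i) - int i}"
  define r where "r = card A"
  have "finite A"
    by (rule finite_subset[of _ "{..max (length p) (nat (- y))}"])
      (auto simp: A_def row_length_def)
  moreover have "m \<in> A" if "k \<in> A" "1 \<le> m" "m \<le> k" for k m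
    using that row_length_antimono[OF p, of m k] by (auto simp: A_def)
  ultimately have A: "A = {1..r}"
    unfolding r_def by (intro finite_down_closed_eq_interval) (auto simp: A_def)
  have "Suc r \<notin> A" using A by auto
  moreover have "int (row_length p (Suc r)) - int (Suc r) \<noteq> y"
    using y unfolding beta_set_def by fastforce
  ultimately have up: "int (row_length p (Suc r)) < y + int r + 1" by (simp add: A_def)
  \<comment> \<open>The solution of \<open>gap p j = y\<close> for a column of length \<open>r\<close>.\<close>
  define j where "j = nat (y + int r + 1)"
  have j: "int j = y + int r + 1" "1 \<le> j" using up by (auto simp: j_def)
  have "row_length p (Suc r) < j" using up j by linarith
  then have "col_length p j \<le> r"
    using le_row_length_iff_le_col_length[OF p, of "Suc r" j] j(2) by auto
  moreover have "r \<le> col_length p j"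
  proof (cases "r = 0")
    case False
    then have "r \<in> A" using A by auto
    then have "j \<le> row_length p r" using j by (simp add: A_def)
    then show ?thesis using le_row_length_iff_le_col_length[OF p, of r j] j(2) False by auto
  qed simp
  ultimately have "gap p j = y" using j by (simp add: gap_def)
  then show thesis using that j(2) by blast
qed

lemma gap_strict_mono:
  assumes "is_partition p" "1 \<le> i" "i < j"
  shows "gap p i < gap p j"
proof -
  have "col_length p j \<le> col_length p i"
    unfolding col_length_def
    by (rule card_mono[OF finite_column]) (use assms in \<open>auto simp: mem_young_diagram_iff\<close>)
  then show ?thesis using assms by (simp add: gap_def)
qed

text \<open>
  Boxes correspond to pairs of a beta number and a smaller gap.
\<close>

lemma core_iff_beta_set:
  assumes p: "is_partition p"
  shows "core s p \<longleftrightarrow> (\<forall>x\<in>beta_set p. \<forall>y. y \<notin> beta_set p \<longrightarrow> y < x \<longrightarrow> \<not> int s dvd x - y)"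
    (is "_ \<longleftrightarrow> ?R")
proof
  assume c: "core s p"
  show ?R
  proof (intro ballI allI impI)
    fix x y assume x: "x \<in> beta_set p" and y: "y \<notin> beta_set p" "y < x"
    obtain i where i: "1 \<le> i" "x = int (row_length p i) - int i"
      using x by (auto simp: beta_set_def)
    obtain j where j: "1 \<le> j" "gap p j = y" using not_beta_is_gap[OF p y(1)] .
    have b: "(i, j) \<in> young_diagram p" using gap_less_beta_iff[OF p i(1) j(1)] i j y by simp
    then have "\<not> s dvd hook_length p i j" using c unfolding core_def by blast
    then have "\<not> int s dvd int (hook_length p i j)" by simp
    then show "\<not> int s dvd x - y" using hook_length_eq_beta_minus_gap[OF p b] i j by metis
  qed
next
  assume r: ?R
  have "\<not> s dvd hook_length p i j" if b: "(i, j) \<in> young_diagram p" for i j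
  proof -
    have ij: "1 \<le> i" "1 \<le> j" using b by (auto simp: mem_young_diagram_iff)
    have "int (row_length p i) - int i \<in> beta_set p" using ij by (auto simp: beta_set_def)
    then have "\<not> int s dvd (int (row_length p i) - int i) - gap p j"
      using r gap_notin_beta_set[OF p ij(2)] gap_less_beta_iff[OF p ij] b by blast
    then show ?thesis using hook_length_eq_beta_minus_gap[OF p b] by (metis int_dvd_int_iff)
  qed
  then show "core s p" using p unfolding core_def by blast
qed

section \<open>Partitions and their diagrams\<close>

lemma young_diagram_inj:
  assumes p: "is_partition p" and q: "is_partition q" and eq: "young_diagram p = young_diagram q"
  shows "p = q"
proof -
  have len: "length r = card {i. (i, 1) \<in> young_diagram r}" if r: "is_partition r" for r
  proof -
    have "1 \<le> r ! (i - 1)" if "1 \<le> i" "i \<le> length r" for i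
      using that r nth_mem[of "i - 1" r] unfolding is_partition_def by (simp add: Suc_le_eq)
    then have "{i. (i, 1) \<in> young_diagram r} = {1..length r}"
      by (auto simp: young_diagram_def)
    then show ?thesis by simp
  qed
  have row: "row_length r i = card {j. (i, j) \<in> young_diagram r}" if "1 \<le> i" for r i
  proof -
    have "{j. (i, j) \<in> young_diagram r} = {1..row_length r i}"
      using that by (auto simp: mem_young_diagram_iff)
    then show ?thesis by simp
  qed
  have l: "length p = length q" using len p q eq by simp
  show ?thesis
  proof (rule nth_equalityI[OF l])
    fix k assume "k < length p"
    then have "p ! k = row_length p (Suc k)" "q ! k = row_length q (Suc k)"
      using l by (auto simp: row_length_def)
    then show "p ! k = q ! k" using row[of "Suc k"] eq by simp
  qed
qed

text \<open>
  Used to produce the doubled distinct partition from its diagram.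
\<close>

lemma partition_of_down_closed:
  fixes D :: "(nat \<times> nat) set"
  assumes fin: "finite D"
    and pos: "\<And>i j. (i, j) \<in> D \<Longrightarrow> 1 \<le> i \<and> 1 \<le> j"
    and down: "\<And>i j i' j'. (i, j) \<in> D \<Longrightarrow> 1 \<le> i' \<Longrightarrow> i' \<le> i \<Longrightarrow> 1 \<le> j' \<Longrightarrow> j' \<le> j \<Longrightarrow> (i', j') \<in> D"
  obtains p where "is_partition p" "young_diagram p = D"
proof -
  define n where "n = card {i. (i, 1) \<in> D}"
  define r where "r i = card {j. (i, j) \<in> D}" for i
  have fin_row: "finite {j. (i, j) \<in> D}" for i
    by (rule finite_subset[OF _ finite_imageI[OF fin, of snd]]) force
  have "{i. (i, 1) \<in> D} = {1..n}"
    unfolding n_def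
  proof (rule finite_down_closed_eq_interval)
    show "finite {i. (i, 1) \<in> D}"
      by (rule finite_subset[OF _ finite_imageI[OF fin, of fst]]) force
  next
    fix k m assume "k \<in> {i. (i, 1) \<in> D}" "1 \<le> m" "m \<le> k"
    then show "m \<in> {i. (i, 1) \<in> D}" using down[of k 1 m 1] by simp
  qed (use pos in blast)
  then have col: "(i, 1) \<in> D \<longleftrightarrow> 1 \<le> i \<and> i \<le> n" for i by auto
  have "{j. (i, j) \<in> D} = {1..r i}" for i
    unfolding r_def
  proof (rule finite_down_closed_eq_interval[OF fin_row])
    fix k m assume "k \<in> {j. (i, j) \<in> D}" "1 \<le> m" "m \<le> k"
    then show "m \<in> {j. (i, j) \<in> D}" using down[of i k i m] pos[of i k] by simp
  qed (use pos in blast)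
  then have row: "(i, j) \<in> D \<longleftrightarrow> 1 \<le> j \<and> j \<le> r i" for i j
    by (metis atLeastAtMost_iff mem_Collect_eq)
  define p where "p = map r [1..<Suc n]"
  have nth: "p ! k = r (Suc k)" if "k < n" for k
    using that by (simp add: p_def del: upt_Suc)
  have len: "length p = n" by (simp add: p_def)
  have "is_partition p"
    unfolding is_partition_def sorted_wrt_iff_nth_less
  proof (intro conjI allI impI ballI)
    fix a b assume ab: "a < b" "b < length p"
    have "(Suc a, j) \<in> D" if "(Suc b, j) \<in> D" for j
      using down[OF that, of "Suc a" j] pos[OF that] ab by simp
    then have "{j. (Suc b, j) \<in> D} \<subseteq> {j. (Suc a, j) \<in> D}" by blast
    then show "p ! b \<le> p ! a" using ab card_mono[OF fin_row] by (simp add: len nth r_def)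
  next
    fix x assume "x \<in> set p"
    then obtain k where "k < n" "x = r (Suc k)" by (metis in_set_conv_nth len nth)
    moreover have "(Suc k, 1) \<in> D" using col \<open>k < n\<close> by simp
    ultimately show "0 < x" using row[of "Suc k" 1] by simp
  qed
  moreover have "young_diagram p = D"
  proof -
    have "(i, j) \<in> young_diagram p \<longleftrightarrow> (i, j) \<in> D" for i j
    proof (cases "1 \<le> i \<and> i \<le> n")
      case True
      then have "p ! (i - 1) = r i" using nth by (cases i) auto
      then show ?thesis using True row[of i j] by (simp add: young_diagram_def len)
    next
      case False
      then have "(i, j) \<notin> D" using pos[of i j] down[of i j i 1] col[of i] by auto
      then show ?thesis using False by (auto simp: young_diagram_def len)
    qed
    then show ?thesis by auto
  qed
  ultimately show thesis using that by blast
qed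

section \<open>The doubled distinct partition and its diagram\<close>

lemma strict_partition_nth_pos:
  assumes "strict_partition l" "1 \<le> k" "k \<le> length l"
  shows "0 < l ! (k - 1)"
  using assms nth_mem[of "k - 1" l] by (auto simp: strict_partition_def)

lemma strict_partition_nth_less:
  assumes "strict_partition l" "1 \<le> k" "k < m" "m \<le> length l"
  shows "l ! (m - 1) < l ! (k - 1)"
  using assms unfolding strict_partition_def sorted_wrt_iff_nth_less by simp

text \<open>
  Row \<open>i\<close> of the shifted diagram ends in column \<open>i + \<lambda>\<^sub>i - 1\<close>. The parts drop by at least one from row
  to row, which makes up for the indentation.
\<close>

lemma strict_partition_shifted_antimono:
  assumes l: "strict_partition l" and "1 \<le> k" "k \<le> m" "m \<le> length l"
  shows "m + l ! (m - 1) \<le> k + l ! (k - 1)"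
  using assms(3,4)
proof (induction m rule: dec_induct)
  case (step m)
  then show ?case using strict_partition_nth_less[OF l, of m "Suc m"] assms(2) by simp
qed simp

lemma mem_set_iff_nth:
  "x \<in> set l \<longleftrightarrow> (\<exists>i. 1 \<le> i \<and> i \<le> length l \<and> x = l ! (i - 1))"
proof
  assume "x \<in> set l"
  then obtain k where "k < length l" "x = l ! k" by (metis in_set_conv_nth)
  then show "\<exists>i. 1 \<le> i \<and> i \<le> length l \<and> x = l ! (i - 1)" by (intro exI[of _ "Suc k"]) simp
qed (auto intro: nth_mem)

lemma shifted_diagram_strict_iff:
  assumes "strict_partition l"
  shows "(i, j) \<in> shifted_diagram l \<longleftrightarrow>
    1 \<le> i \<and> i \<le> length l \<and> i \<le> j \<and> j + 1 \<le> i + l ! (i - 1)"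
  using strict_partition_nth_pos[OF assms, of i] by (auto simp: shifted_diagram_def)

text \<open>
  The \<open>i\<close>th diagonal box of the doubled partition has arm \<open>\<lambda>\<^sub>i\<close> and leg \<open>\<lambda>\<^sub>i - 1\<close>. The boxes of the
  \<open>i\<close>th arm are row \<open>i\<close> of the shifted diagram moved one column to the right, and the diagonal box
  together with its leg is the transpose of that row.
\<close>

definition double_diagram :: "nat list \<Rightarrow> (nat \<times> nat) set" where
  "double_diagram l = {(i, j + 1) | i j. (i, j) \<in> shifted_diagram l} \<union> (shifted_diagram l)\<inverse>"

lemma mem_double_diagram_iff:
  "(i, j) \<in> double_diagram l \<longleftrightarrow>
    (if i < j then (i, j - 1) \<in> shifted_diagram l else (j, i) \<in> shifted_diagram l)"
proof -
  have "i \<le> j" if "(i, j) \<in> shifted_diagram l" for i j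
    using that by (simp add: shifted_diagram_def)
  then show ?thesis unfolding double_diagram_def by (cases j) (auto, force+)
qed

lemma mem_double_diagram_nth_iff:
  assumes l: "strict_partition l"
  shows "(i, j) \<in> double_diagram l \<longleftrightarrow> 1 \<le> i \<and> 1 \<le> j \<and>
    (if i < j then i \<le> length l \<and> j \<le> i + l ! (i - 1)
     else j \<le> length l \<and> i + 1 \<le> j + l ! (j - 1))"
  by (auto simp: mem_double_diagram_iff shifted_diagram_strict_iff[OF l])

lemma double_diagram_down_closed:
  assumes l: "strict_partition l" and b: "(i, j) \<in> double_diagram l"
    and "1 \<le> i'" "i' \<le> i" "1 \<le> j'" "j' \<le> j"
  shows "(i', j') \<in> double_diagram l"
proof -
  note anti = strict_partition_shifted_antimono[OF l]
  note pos = strict_partition_nth_pos[OF l]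
  show ?thesis
  proof (cases "i' < j'")
    case True
    have "i' \<le> length l \<and> j' \<le> i' + l ! (i' - 1)"
    proof (cases "i < j")
      case True
      then show ?thesis using b assms(3-) anti[of i' i] by (simp add: mem_double_diagram_nth_iff[OF l])
    next
      case False
      then show ?thesis using b assms(3-) \<open>i' < j'\<close> anti[of i' j']
        by (simp add: mem_double_diagram_nth_iff[OF l])
    qed
    then show ?thesis using True assms(3-) by (simp add: mem_double_diagram_nth_iff[OF l])
  next
    case False
    have "j' \<le> length l \<and> i' + 1 \<le> j' + l ! (j' - 1)"
    proof (cases "i < j")
      case True
      then show ?thesis using b assms(3-) False anti[of j' i'] pos[of i']
        by (simp add: mem_double_diagram_nth_iff[OF l])
    next
      case False
      then show ?thesis using b assms(3-) anti[of j' j]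
        by (simp add: mem_double_diagram_nth_iff[OF l])
    qed
    then show ?thesis using False assms(3-) by (simp add: mem_double_diagram_nth_iff[OF l])
  qed
qed

lemma finite_double_diagram:
  assumes l: "strict_partition l"
  shows "finite (double_diagram l)"
proof -
  have "l ! (k - 1) \<le> sum_list l" if "1 \<le> k" "k \<le> length l" for k
    using that by (intro elem_le_sum_list) simp
  then have "k + l ! (k - 1) \<le> length l + sum_list l" if "1 \<le> k" "k \<le> length l" for k
    using that by (simp add: add_mono)
  then have bound: "m \<le> length l + sum_list l"
    if "m \<le> k + l ! (k - 1)" "1 \<le> k" "k \<le> length l" for k m
    using that order_trans by blast
  have "double_diagram l \<subseteq> {..length l + sum_list l} \<times> {..length l + sum_list l}"
  proof
    fix b assume "b \<in> double_diagram l"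
    moreover obtain i j where "b = (i, j)" by force
    ultimately show "b \<in> {..length l + sum_list l} \<times> {..length l + sum_list l}"
      using bound[of i i] bound[of j i] bound[of i j] bound[of j j]
      by (simp add: mem_double_diagram_nth_iff[OF l] split: if_splits)
  qed
  then show ?thesis by (rule finite_subset) simp
qed

lemma diagonal_length_iff:
  assumes p: "is_partition p" and i: "1 \<le> i"
  shows "i \<le> row_length p i \<longleftrightarrow> i \<le> diagonal_length p"
proof -
  have "{i. (i, i) \<in> young_diagram p} = {1..diagonal_length p}"
    unfolding diagonal_length_def
  proof (rule finite_down_closed_eq_interval)
    show "finite {i. (i, i) \<in> young_diagram p}"
      by (rule finite_subset[of _ "{..length p}"]) (auto simp: young_diagram_def)
  next
    fix k m assume "k \<in> {i. (i, i) \<in> young_diagram p}" "1 \<le> m" "m \<le> k"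
    then show "m \<in> {i. (i, i) \<in> young_diagram p}"
      using row_length_antimono[OF p, of m k] by (simp add: mem_young_diagram_iff)
  qed (simp add: mem_young_diagram_iff)
  then have "(i, i) \<in> young_diagram p \<longleftrightarrow> i \<in> {1..diagonal_length p}" by blast
  then show ?thesis using i by (simp add: mem_young_diagram_iff)
qed

text \<open>
  The arm and the leg of the \<open>i\<close>th diagonal box are the lengths of row \<open>i\<close> and column \<open>i\<close>, each less \<open>i\<close>.
\<close>

lemma is_double_of_iff_row_col:
  assumes p: "is_partition p" and l: "strict_partition l"
  shows "is_double_of l p \<longleftrightarrow> length l = diagonal_length p \<and>
     (\<forall>i. 1 \<le> i \<and> i \<le> length l \<longrightarrow>
        row_length p i = i + l ! (i - 1) \<and> col_length p i + 1 = i + l ! (i - 1))"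
proof -
  have nth_upt: "[1..<n + 1] ! k = Suc k" if "k < n" for n k :: nat
    using that by (simp del: upt_Suc)
  have map_eq: "map f [1..<diagonal_length p + 1] = xs \<longleftrightarrow>
      length xs = diagonal_length p \<and> (\<forall>i. 1 \<le> i \<and> i \<le> diagonal_length p \<longrightarrow> f i = xs ! (i - 1))"
    for f :: "nat \<Rightarrow> nat" and xs
  proof
    assume "length xs = diagonal_length p \<and> (\<forall>i. 1 \<le> i \<and> i \<le> diagonal_length p \<longrightarrow> f i = xs ! (i - 1))"
    then show "map f [1..<diagonal_length p + 1] = xs"
      by (intro nth_equalityI) (simp_all add: nth_upt del: upt_Suc)
  next
    assume "map f [1..<diagonal_length p + 1] = xs"
    then have "length xs = diagonal_length p" "\<And>k. k < diagonal_length p \<Longrightarrow> f (Suc k) = xs ! k"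
      by (auto simp: nth_upt simp del: upt_Suc)
    then show "length xs = diagonal_length p \<and> (\<forall>i. 1 \<le> i \<and> i \<le> diagonal_length p \<longrightarrow> f i = xs ! (i - 1))"
      by (auto simp: Suc_le_eq gr0_conv_Suc)
  qed
  have "arm_length p i i = l ! (i - 1) \<longleftrightarrow> row_length p i = i + l ! (i - 1)"
    "leg_length p i i = map (\<lambda>x. x - 1) l ! (i - 1) \<longleftrightarrow> col_length p i + 1 = i + l ! (i - 1)"
    if "1 \<le> i" "i \<le> length l" "length l = diagonal_length p" for i
    using that diagonal_length_iff[OF p, of i] le_row_length_iff_le_col_length[OF p, of i i]
      strict_partition_nth_pos[OF l, of i]
    by (auto simp: arm_length_eq leg_length_eq[OF p])
  then show ?thesis
    using p l unfolding is_double_of_def frobenius_symbol_def prod.inject map_eq by auto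
qed

lemma is_double_of_iff_diagram:
  assumes p: "is_partition p" and l: "strict_partition l"
  shows "is_double_of l p \<longleftrightarrow> young_diagram p = double_diagram l"
proof -
  note diag = diagonal_length_iff[OF p]
  note rowcol = le_row_length_iff_le_col_length[OF p]
  show ?thesis
    unfolding is_double_of_iff_row_col[OF p l]
  proof
    assume F: "length l = diagonal_length p \<and>
     (\<forall>i. 1 \<le> i \<and> i \<le> length l \<longrightarrow>
        row_length p i = i + l ! (i - 1) \<and> col_length p i + 1 = i + l ! (i - 1))"
    have "(i, j) \<in> young_diagram p \<longleftrightarrow> (i, j) \<in> double_diagram l" for i j
    proof (cases "1 \<le> i \<and> 1 \<le> j")
      case True
      show ?thesis
      proof (cases "i < j")
        case lt: True
        then show ?thesis using True F diag[of i]
          by (auto simp: mem_young_diagram_iff mem_double_diagram_nth_iff[OF l])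
      next
        case False
        have "i \<le> col_length p j \<longleftrightarrow> j \<le> length l \<and> i + 1 \<le> j + l ! (j - 1)"
          using True F diag[of j] rowcol[of j j] False by auto
        then show ?thesis using False True rowcol[of i j]
          by (auto simp: mem_young_diagram_iff mem_double_diagram_nth_iff[OF l])
      qed
    qed (auto simp: mem_young_diagram_iff mem_double_diagram_nth_iff[OF l])
    then show "young_diagram p = double_diagram l" by auto
  next
    assume eq: "young_diagram p = double_diagram l"
    have mem: "j \<le> row_length p i \<longleftrightarrow> (i, j) \<in> double_diagram l" if "1 \<le> i" "1 \<le> j" for i j
      using that eq mem_young_diagram_iff[of i j p] by auto
    have "1 \<le> i \<and> i \<le> diagonal_length p \<longleftrightarrow> 1 \<le> i \<and> i \<le> length l" for i
      using diag[of i] mem[of i i] strict_partition_nth_pos[OF l, of i]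
      by (auto simp: mem_double_diagram_nth_iff[OF l])
    then have len: "length l = diagonal_length p"
      by (metis One_nat_def le_antisym le_refl not_less_eq_eq bot_nat_0.extremum)
    moreover have "row_length p i = i + l ! (i - 1)" if i: "1 \<le> i" "i \<le> length l" for i
    proof -
      have "j \<le> row_length p i \<longleftrightarrow> j \<le> i + l ! (i - 1)" if "i < j" for j
        using mem[of i j] i that by (simp add: mem_double_diagram_nth_iff[OF l])
      from this[of "Suc (i + l ! (i - 1))"] this[of "i + l ! (i - 1)"]
      show ?thesis using strict_partition_nth_pos[OF l i] by simp
    qed
    moreover have "col_length p i + 1 = i + l ! (i - 1)" if i: "1 \<le> i" "i \<le> length l" for i
    proof -
      have "j \<le> col_length p i \<longleftrightarrow> j + 1 \<le> i + l ! (i - 1)" if "i \<le> j" for j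
        using mem[of j i] rowcol[of j i] i that by (simp add: mem_double_diagram_nth_iff[OF l])
      from this[of "i + l ! (i - 1)"] this[of "i + l ! (i - 1) - 1"]
      show ?thesis using strict_partition_nth_pos[OF l i] by arith
    qed
    ultimately show "length l = diagonal_length p \<and>
     (\<forall>i. 1 \<le> i \<and> i \<le> length l \<longrightarrow>
        row_length p i = i + l ! (i - 1) \<and> col_length p i + 1 = i + l ! (i - 1))" by blast
  qed
qed

lemma ex_double:
  assumes l: "strict_partition l"
  obtains p where "is_double_of l p"
proof -
  obtain p where "is_partition p" "young_diagram p = double_diagram l"
    using partition_of_down_closed[OF finite_double_diagram[OF l]]
      double_diagram_down_closed[OF l] mem_double_diagram_nth_iff[OF l] by metis
  then show thesis using that is_double_of_iff_diagram[OF _ l] by blast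
qed

lemma double_unique:
  assumes "is_double_of l p" "is_double_of l q"
  shows "p = q"
  using assms young_diagram_inj is_double_of_iff_diagram unfolding is_double_of_def by metis

section \<open>The beta set of a doubled distinct partition\<close>

text \<open>
  Beta set of the doubled distinct partition whose strict partition has the set \<open>L\<close> of parts. It is
  antisymmetric around \<open>0\<close>, and \<open>0\<close> itself is left out.
\<close>

definition doubled_set :: "nat set \<Rightarrow> int set" where
  "doubled_set L = {x. 0 < x \<and> nat x \<in> L} \<union> {x. x < 0 \<and> nat (- x) \<notin> L}"

lemma doubled_set_simps [simp]:
  "0 \<notin> doubled_set L"
  "0 < n \<Longrightarrow> int n \<in> doubled_set L \<longleftrightarrow> n \<in> L"
  by (auto simp: doubled_set_def)

lemma uminus_mem_doubled_set_iff:
  "x \<noteq> 0 \<Longrightarrow> - x \<in> doubled_set L \<longleftrightarrow> x \<notin> doubled_set L"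
  by (auto simp: doubled_set_def)

text \<open>
  Row \<open>i\<close> and column \<open>i\<close> through the \<open>i\<close>th diagonal box have opposite labels.
\<close>

lemma double_row_beta:
  assumes d: "is_double_of l p" and i: "1 \<le> i" "i \<le> length l"
  shows "int (row_length p i) - int i = int (l ! (i - 1))"
    and "gap p i = - int (l ! (i - 1))"
proof -
  have "row_length p i = i + l ! (i - 1) \<and> col_length p i + 1 = i + l ! (i - 1)"
    using d i is_double_of_iff_row_col[of p l] unfolding is_double_of_def by blast
  then show "int (row_length p i) - int i = int (l ! (i - 1))"
    and "gap p i = - int (l ! (i - 1))" by (simp_all add: gap_def)
qed

text \<open>
  The nonnegative beta numbers and the negative gaps belong to the rows and columns that meet the
  diagonal, and these have the labels \<open>\<lambda>\<^sub>i\<close> and \<open>- \<lambda>\<^sub>i\<close>.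
\<close>

lemma beta_set_double:
  assumes d: "is_double_of l p"
  shows "beta_set p = doubled_set (set l)"
proof -
  have p: "is_partition p" and l: "strict_partition l" using d by (simp_all add: is_double_of_def)
  have len: "length l = diagonal_length p" using d is_double_of_iff_row_col[OF p l] by blast
  note diag = diagonal_length_iff[OF p, folded len]
  have pos: "x \<in> beta_set p \<longleftrightarrow> 0 < x \<and> nat x \<in> set l" if "0 \<le> x" for x
  proof
    assume "x \<in> beta_set p"
    then obtain i where i: "1 \<le> i" "x = int (row_length p i) - int i" by (auto simp: beta_set_def)
    then have "i \<le> length l" using diag[of i] that by linarith
    then show "0 < x \<and> nat x \<in> set l"
      using i double_row_beta(1)[OF d] strict_partition_nth_pos[OF l i(1)] mem_set_iff_nth by auto
  next
    assume x: "0 < x \<and> nat x \<in> set l"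
    then obtain i where i: "1 \<le> i" "i \<le> length l" "nat x = l ! (i - 1)"
      using mem_set_iff_nth by metis
    then have "x = int (row_length p i) - int i" using double_row_beta(1)[OF d] x by simp
    then show "x \<in> beta_set p" using i by (auto simp: beta_set_def)
  qed
  have neg: "x \<in> beta_set p \<longleftrightarrow> nat (- x) \<notin> set l" if "x < 0" for x
  proof -
    have "x \<notin> beta_set p \<longleftrightarrow> (\<exists>j\<ge>1. gap p j = x)"
      using not_beta_is_gap[OF p] gap_notin_beta_set[OF p] by metis
    also have "\<dots> \<longleftrightarrow> (\<exists>j\<ge>1. j \<le> length l \<and> gap p j = x)"
    proof -
      have "j \<le> length l" if "1 \<le> j" "gap p j = x" for j
        using that \<open>x < 0\<close> diag[of j] le_row_length_iff_le_col_length[OF p, of j j]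
        by (simp add: gap_def)
      then show ?thesis by blast
    qed
    also have "\<dots> \<longleftrightarrow> (\<exists>j\<ge>1. j \<le> length l \<and> nat (- x) = l ! (j - 1))"
      using double_row_beta(2)[OF d] that by auto
    also have "\<dots> \<longleftrightarrow> nat (- x) \<in> set l" using mem_set_iff_nth[of _ l] by blast
    finally show ?thesis by blast
  qed
  show ?thesis
  proof (rule set_eqI)
    show "x \<in> beta_set p \<longleftrightarrow> x \<in> doubled_set (set l)" for x
      using pos[of x] neg[of x] by (cases "0 \<le> x") (auto simp: doubled_set_def)
  qed
qed

section \<open>Shifted hook lengths as hook lengths of the doubled partition\<close>

text \<open>
  The arm is the same in both diagrams. The leg in the doubled diagram starts with the boxes
  below \<open>(i, j)\<close> in column \<open>j\<close> of the shifted diagram; from row \<open>j + 1\<close> on it runs in the transposed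
  copy, where column \<open>j + 1\<close> is row \<open>j + 1\<close> of the shifted diagram. This explains the extra row in the
  definition of a shifted hook.
\<close>

lemma shifted_hook_length_eq_hook_length_double:
  assumes d: "is_double_of l p" and b: "(i, j) \<in> shifted_diagram l"
  shows "shifted_hook_length l i j = hook_length p i (j + 1)"
proof -
  have p: "is_partition p" and l: "strict_partition l" using d by (simp_all add: is_double_of_def)
  have D: "young_diagram p = double_diagram l" using d is_double_of_iff_diagram[OF p l] by blast
  have ord: "a \<le> b" if "(a, b) \<in> shifted_diagram l" for a b
    using that by (simp add: shifted_diagram_def)
  have ij: "i \<le> j" by (rule ord[OF b])
  have right: "(a, Suc b) \<in> young_diagram p \<longleftrightarrow> (a, b) \<in> shifted_diagram l" if "a \<le> b" for a b
    using that by (simp add: D mem_double_diagram_iff)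
  have below: "(a, b) \<in> young_diagram p \<longleftrightarrow> (b, a) \<in> shifted_diagram l" if "b \<le> a" for a b
    using that by (simp add: D mem_double_diagram_iff)
  define R where "R = {j'. j < j' \<and> (i, j') \<in> shifted_diagram l}"
  define B where "B = {i'. i < i' \<and> (i', j) \<in> shifted_diagram l}"
  define N where "N = {j'. (j + 1, j') \<in> shifted_diagram l}"
  have fin: "finite (shifted_diagram l)"
  proof -
    have "finite ((shifted_diagram l)\<inverse>)"
      by (rule finite_subset[OF _ finite_double_diagram[OF l]]) (simp add: double_diagram_def)
    then show ?thesis by simp
  qed
  have finR: "finite R" and finN: "finite N"
    by (rule finite_subset[OF _ finite_imageI[OF fin, of snd]], force simp: R_def N_def)+
  have finB: "finite B"
    by (rule finite_subset[OF _ finite_imageI[OF fin, of fst]]) (force simp: B_def)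
  have arm: "arm_length p i (j + 1) = card R"
  proof -
    have "{j'. j + 1 < j' \<and> (i, j') \<in> young_diagram p} = Suc ` R"
    proof (rule set_eqI)
      show "k \<in> {j'. j + 1 < j' \<and> (i, j') \<in> young_diagram p} \<longleftrightarrow> k \<in> Suc ` R" for k
        using ij right[of i "k - 1"] by (cases k) (simp_all add: R_def inj_image_mem_iff, linarith)
    qed
    then show ?thesis by (simp add: arm_length_def card_image)
  qed
  have leg: "leg_length p i (j + 1) = card B + card N"
  proof -
    have "k \<in> {i'. i < i' \<and> (i', j + 1) \<in> young_diagram p} \<longleftrightarrow> k \<in> B \<union> N" for k
    proof (cases "k \<le> j")
      case True
      then have "k \<notin> N" using ord[of "j + 1" k] by (auto simp: N_def)
      then show ?thesis using True right[of k j] by (simp add: B_def)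
    next
      case False
      then have "k \<notin> B" using ord[of k j] by (auto simp: B_def)
      then show ?thesis using False ij below[of "j + 1" k] by (simp add: N_def)
    qed
    then have "{i'. i < i' \<and> (i', j + 1) \<in> young_diagram p} = B \<union> N" by blast
    moreover have "k \<le> j" if "k \<in> B" for k using that ord by (simp add: B_def)
    moreover have "j < k" if "k \<in> N" for k using that ord[of "j + 1" k] by (simp add: N_def)
    ultimately show ?thesis
      unfolding leg_length_def using finB finN by (metis card_Un_disjoint disjoint_iff not_le)
  qed
  have hook: "shifted_hook l i j = insert (i, j) (Pair i ` R \<union> ((\<lambda>k. (k, j)) ` B \<union> Pair (j + 1) ` N))"
    unfolding shifted_hook_def R_def B_def N_def by blast
  have "card (shifted_hook l i j) = Suc (card R + (card B + card N))"
  proof -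
    have "(\<lambda>k. (k, j)) ` B \<inter> Pair (j + 1) ` N = {}"
      using ord[of "j + 1" j] by (auto simp: N_def)
    then have "card ((\<lambda>k. (k, j)) ` B \<union> Pair (j + 1) ` N) = card B + card N"
      using finB finN by (simp add: card_Un_disjoint card_image inj_on_def)
    moreover have "Pair i ` R \<inter> ((\<lambda>k. (k, j)) ` B \<union> Pair (j + 1) ` N) = {}"
      using ij by (auto simp: R_def)
    then have "card (Pair i ` R \<union> ((\<lambda>k. (k, j)) ` B \<union> Pair (j + 1) ` N))
        = card R + card ((\<lambda>k. (k, j)) ` B \<union> Pair (j + 1) ` N)"
      using finR finB finN by (simp add: card_Un_disjoint card_image inj_on_def)
    moreover have "(i, j) \<notin> Pair i ` R \<union> ((\<lambda>k. (k, j)) ` B \<union> Pair (j + 1) ` N)"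
      using ij by (auto simp: R_def B_def)
    ultimately show ?thesis unfolding hook using finR finB finN by simp
  qed
  then show ?thesis using arm leg by (simp add: shifted_hook_length_def hook_length_def)
qed

text \<open>
  The boxes that represent the shifted diagram are those of row \<open>i\<close> in columns to the right of
  column \<open>i\<close>. Column \<open>i\<close> has label \<open>- \<lambda>\<^sub>i\<close> and column labels increase, so these are the boxes
  whose column has a label above \<open>- \<lambda>\<^sub>i\<close>.
\<close>

lemma csyd_iff:
  assumes l: "strict_partition l"
  shows "csyd s l \<longleftrightarrow> (\<forall>n\<in>set l. \<forall>y. y \<notin> doubled_set (set l) \<longrightarrow> - int n < y \<longrightarrow> y < int n \<longrightarrow>
    \<not> int s dvd int n - y)"
    (is "_ \<longleftrightarrow> ?R")
proof -
  obtain p where d: "is_double_of l p" using ex_double[OF l] .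
  then have p: "is_partition p" by (simp add: is_double_of_def)
  have X: "beta_set p = doubled_set (set l)" by (rule beta_set_double[OF d])
  have D: "young_diagram p = double_diagram l" using d is_double_of_iff_diagram[OF p l] by blast
  note beta = double_row_beta[OF d]
  have box: "(i, j) \<in> shifted_diagram l \<longleftrightarrow> i \<le> j \<and> (i, j + 1) \<in> young_diagram p" for i j
    by (auto simp: D mem_double_diagram_iff shifted_diagram_def)
  have hook: "int (shifted_hook_length l i j) = int (l ! (i - 1)) - gap p (j + 1)"
    if b: "(i, j) \<in> shifted_diagram l" for i j
  proof -
    have "1 \<le> i" "i \<le> length l" using b by (auto simp: shifted_diagram_def)
    then show ?thesis
      using hook_length_eq_beta_minus_gap[OF p, of i "j + 1"] b box beta(1)
      unfolding shifted_hook_length_eq_hook_length_double[OF d b] by simp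
  qed
  show ?thesis
  proof
    assume c: "csyd s l"
    show ?R
    proof (intro ballI allI impI)
      fix n y assume n: "n \<in> set l" and y: "y \<notin> doubled_set (set l)" "- int n < y" "y < int n"
      obtain i where i: "1 \<le> i" "i \<le> length l" "n = l ! (i - 1)" using n mem_set_iff_nth by metis
      obtain j where j: "1 \<le> j" "gap p j = y" using not_beta_is_gap[OF p] y(1) X by metis
      have "i < j"
      proof (rule ccontr)
        assume "\<not> i < j"
        then have "gap p j \<le> gap p i" using gap_strict_mono[OF p j(1), of i] by (cases "i = j") auto
        then show False using beta(2)[OF i(1,2)] i j y by simp
      qed
      moreover have "(i, j) \<in> young_diagram p"
        using gap_less_beta_iff[OF p i(1) j(1)] beta(1)[OF i(1,2)] i j y by simp
      ultimately have b: "(i, j - 1) \<in> shifted_diagram l" using box[of i "j - 1"] by simp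
      then have "\<not> s dvd shifted_hook_length l i (j - 1)" using c unfolding csyd_def by blast
      moreover have "int (shifted_hook_length l i (j - 1)) = int n - y" using hook[OF b] i j by simp
      ultimately show "\<not> int s dvd int n - y" by (metis int_dvd_int_iff)
    qed
  next
    assume r: ?R
    have "\<not> s dvd shifted_hook_length l i j" if b: "(i, j) \<in> shifted_diagram l" for i j
    proof -
      have i: "1 \<le> i" "i \<le> length l" and "i < j + 1" using b by (auto simp: shifted_diagram_def)
      have "l ! (i - 1) \<in> set l" using i by (intro nth_mem) linarith
      moreover have "gap p (j + 1) \<notin> doubled_set (set l)" using gap_notin_beta_set[OF p] X by auto
      moreover have "- int (l ! (i - 1)) < gap p (j + 1)"
        using gap_strict_mono[OF p i(1) \<open>i < j + 1\<close>] beta(2)[OF i] by simp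
      moreover have "gap p (j + 1) < int (l ! (i - 1))"
        using gap_less_beta_iff[OF p i(1), of "j + 1"] b box beta(1)[OF i] by simp
      ultimately have "\<not> int s dvd int (l ! (i - 1)) - gap p (j + 1)" using r by blast
      then show ?thesis using hook[OF b] by (metis int_dvd_int_iff)
    qed
    then show "csyd s l" using l unfolding csyd_def by blast
  qed
qed

section \<open>The two core conditions on the set of parts\<close>

definition closed_under_sub :: "nat \<Rightarrow> int set \<Rightarrow> bool" where
  "closed_under_sub s X \<longleftrightarrow> (\<forall>x\<in>X. x - int s \<in> X)"

lemma closed_under_sub_iff:
  assumes s: "0 < s"
  shows "(\<forall>x\<in>X. \<forall>y. y \<notin> X \<longrightarrow> y < x \<longrightarrow> \<not> int s dvd x - y) \<longleftrightarrow> closed_under_sub s X"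
    (is "?L \<longleftrightarrow> _")
proof
  assume ?L
  then have "x - int s \<in> X" if "x \<in> X" for x
  proof (rule contrapos_pp)
    assume "x - int s \<notin> X"
    moreover have "int s dvd x - (x - int s)" "x - int s < x" using s by simp_all
    ultimately show "\<not> (\<forall>x\<in>X. \<forall>y. y \<notin> X \<longrightarrow> y < x \<longrightarrow> \<not> int s dvd x - y)"
      using that by blast
  qed
  then show "closed_under_sub s X" by (simp add: closed_under_sub_def)
next
  assume c: "closed_under_sub s X"
  have iter: "x - int s * int k \<in> X" if "x \<in> X" for x k
  proof (induction k)
    case (Suc k)
    then have "x - int s * int k - int s \<in> X" using c by (simp add: closed_under_sub_def)
    then show ?case by (simp add: algebra_simps)
  qed (use that in simp)
  show ?L
  proof (intro ballI allI impI notI)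
    fix x y assume xy: "x \<in> X" "y \<notin> X" "y < x" "int s dvd x - y"
    then obtain m where m: "x - y = int s * m" by blast
    then have "0 < int s * m" using xy(3) by linarith
    then have "0 \<le> m" using s by (simp add: zero_less_mult_iff)
    then have "y = x - int s * int (nat m)" using m by simp
    then show False using iter[OF xy(1)] xy(2) by blast
  qed
qed

text \<open>
  The \<open>s\<close>-CSYD condition in terms of the set of parts; the differences that occur here are the bar
  lengths of the strict partition.
\<close>

definition bar_core :: "nat \<Rightarrow> nat set \<Rightarrow> bool" where
  "bar_core s L \<longleftrightarrow> (\<forall>n\<in>L. \<forall>y. y \<notin> doubled_set L \<longrightarrow> - int n < y \<longrightarrow> y < int n \<longrightarrow>
    \<not> int s dvd int n - y)"

lemma bar_coreD:
  assumes "bar_core s L" "n \<in> L" "- int n < y" "y < int n" "int s dvd int n - y"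
  shows "y \<in> doubled_set L"
  using assms unfolding bar_core_def by blast

lemma closed_under_sub_dvd:
  assumes "0 < s" "closed_under_sub s X" "x \<in> X" "y < x" "int s dvd x - y"
  shows "y \<in> X"
  using assms closed_under_sub_iff by blast

text \<open>
  A difference \<open>x - y\<close> with \<open>x > 0\<close> and \<open>- x < y\<close> is a bar length. The reflection that sends \<open>(x, y)\<close> to
  \<open>(- y, - x)\<close> reduces all other differences to these, except \<open>x - (- x) = 2 x\<close>. If \<open>s\<close> divides \<open>2 x\<close> but
  not \<open>x\<close>, then \<open>s\<close> is even and \<open>x\<close> is an odd multiple of \<open>s div 2\<close>; as bar lengths are not divisible
  by \<open>s\<close>, subtracting a multiple of \<open>s\<close> shows that \<open>s div 2\<close> is a part as well.
\<close>

lemma closed_under_sub_iff_bar_core: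
  assumes s: "0 < s" and L: "0 \<notin> L"
  shows "closed_under_sub s (doubled_set L) \<longleftrightarrow> bar_core s L \<and> \<not> (even s \<and> s div 2 \<in> L)"
proof -
  let ?X = "doubled_set L"
  have memX: "int n \<in> ?X" if "n \<in> L" for n
    using that L by (metis doubled_set_simps(2) neq0_conv)
  show ?thesis
  proof
    assume c: "closed_under_sub s ?X"
    have "bar_core s L"
      unfolding bar_core_def using closed_under_sub_dvd[OF s c memX] by blast
    moreover have "s div 2 \<notin> L" if "even s"
    proof
      assume h: "s div 2 \<in> L"
      have "int (s div 2) - (- int (s div 2)) = int s" using that by auto
      then have "- int (s div 2) \<in> ?X"
        using closed_under_sub_dvd[OF s c memX[OF h], of "- int (s div 2)"] s by simp
      then show False
        using uminus_mem_doubled_set_iff[of "int (s div 2)" L] memX[OF h] h L by (cases "s div 2 = 0") auto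
    qed
    ultimately show "bar_core s L \<and> \<not> (even s \<and> s div 2 \<in> L)" by blast
  next
    assume b: "bar_core s L \<and> \<not> (even s \<and> s div 2 \<in> L)"
    \<comment> \<open>The bar length \<open>n - 0\<close>.\<close>
    have no_mult: "\<not> int s dvd int n" if "n \<in> L" for n
      using bar_coreD[of s L n 0] b that L by (metis diff_zero doubled_set_simps(1) neg_less_0_iff_less neq0_conv of_nat_0_less_iff)
    have no_double: "\<not> int s dvd 2 * int n" if n: "n \<in> L" for n
    proof
      assume d: "int s dvd 2 * int n"
      show False
      proof (cases "even s")
        case False
        then have "coprime (int s) 2" by simp
        then show False using d no_mult[OF n] coprime_dvd_mult_right_iff by blast
      next
        case True
        then obtain m where m: "s = 2 * m" by blast
        then have "int m dvd int n" using d by simp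
        then obtain c where c: "n = m * c" by auto
        have "odd c" using no_mult[OF n] m c by (auto elim!: evenE)
        then obtain k where k: "c = 2 * k + 1" by (elim oddE)
        have "m \<notin> L" using b m by simp
        then have "0 < k" using n c k by (cases k) auto
        have m0: "0 < m" using m s by simp
        \<comment> \<open>Hence \<open>n - m\<close> is a multiple of \<open>s\<close>; it would be a bar length if \<open>m\<close> were not a part.\<close>
        have "int n = int m + int s * int k" using c k m by (simp add: algebra_simps)
        moreover have "0 < int s * int k" using s \<open>0 < k\<close> by simp
        ultimately have "int m \<in> doubled_set L"
          using bar_coreD[of s L n "int m"] b n by simp
        then show False using \<open>m \<notin> L\<close> m0 by simp
      qed
    qed
    have "\<not> int s dvd x - y" if x: "x \<in> ?X" and y: "y \<notin> ?X" "y < x" for x y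
    proof
      assume d: "int s dvd x - y"
      have pos_case: False
        if "x \<in> ?X" "y \<notin> ?X" "0 < x" "- x \<le> y" "y < x" "int s dvd x - y" for x y
      proof -
        have n: "nat x \<in> L" using that by (auto simp: doubled_set_def)
        show False
        proof (cases "y = - x")
          case True
          then show False using that no_double[OF n] by simp
        next
          case False
          then show False using bar_coreD[of s L "nat x" y] b n that by simp
        qed
      qed
      show False
      proof (cases "0 < x \<and> - x \<le> y")
        case True
        then show False using pos_case[OF x y(1)] y d by blast
      next
        case False
        have "x \<noteq> 0" using x by auto
        then have "y < 0" "- (- y) \<le> - x" using False y by auto
        moreover have "- y \<in> ?X" "- x \<notin> ?X"
          using x y \<open>y < 0\<close> \<open>x \<noteq> 0\<close> uminus_mem_doubled_set_iff by auto
        moreover have "int s dvd - y - - x" using d by simp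
        ultimately show False using pos_case[of "- y" "- x"] y(2) by simp
      qed
    qed
    then show "closed_under_sub s ?X" using closed_under_sub_iff[OF s] by blast
  qed
qed

section \<open>Height functions of simultaneous cores\<close>

text \<open>
  The sets of parts whose doubled distinct partitions are simultaneous \<open>s\<close>- and \<open>t\<close>-cores.
\<close>

definition core_sets :: "nat \<Rightarrow> nat \<Rightarrow> nat set set" where
  "core_sets s t = {L. finite L \<and> 0 \<notin> L \<and>
     closed_under_sub s (doubled_set L) \<and> closed_under_sub t (doubled_set L)}"

text \<open>
  On an abacus with one runner for each residue class modulo \<open>s\<close>, where \<open>i\<close> names the class of \<open>t i\<close>,
  the value \<open>h i\<close> marks the topmost bead of a runner. Indexing by all integers \<open>i\<close> instead of
  residues turns closure under subtraction of \<open>t\<close> into monotonicity.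
\<close>

definition profile :: "nat \<Rightarrow> nat \<Rightarrow> int set \<Rightarrow> (int \<Rightarrow> int) \<Rightarrow> bool" where
  "profile s t X h \<longleftrightarrow> (\<forall>i k. int t * i - int s * k \<in> X \<longleftrightarrow> h i \<le> k)"

text \<open>
  What closure under \<open>t\<close>, the ambiguity of the representation \<open>t i - s k\<close>, and the antisymmetry of
  \<open>doubled_set\<close> mean for a profile. The value at \<open>0\<close> is exceptional because \<open>0\<close> is its own reflection
  and is missing from the set: \<open>h 0 + h 0 = 2\<close>.
\<close>

definition admissible :: "nat \<Rightarrow> nat \<Rightarrow> (int \<Rightarrow> int) \<Rightarrow> bool" where
  "admissible s t h \<longleftrightarrow> (\<forall>i. h i \<le> h (i + 1)) \<and> (\<forall>i. h (i + int s) = h i + int t) \<and>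
     h 0 = 1 \<and> (\<forall>i. \<not> int s dvd i \<longrightarrow> h i + h (- i) = 1)"

lemma admissibleD:
  assumes "admissible s t h"
  shows "h i \<le> h (i + 1)" "h (i + int s) = h i + int t" "h 0 = 1"
    "\<not> int s dvd i \<Longrightarrow> h i + h (- i) = 1"
  using assms by (simp_all add: admissible_def)

lemma admissible_mono:
  assumes "admissible s t h" "i \<le> j"
  shows "h i \<le> h j"
  using assms(2)
proof (induction j rule: int_ge_induct)
  case (step j)
  then show ?case using admissibleD(1)[OF assms(1), of j] by linarith
qed simp

lemma admissible_periodic:
  assumes h: "admissible s t h"
  shows "h (i + int s * m) = h i + int t * m"
proof -
  have nat: "h (i + int s * int k) = h i + int t * int k" for i k
  proof (induction k)
    case (Suc k)
    then show ?case using admissibleD(2)[OF h, of "i + int s * int k"] by (simp add: algebra_simps)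
  qed simp
  show ?thesis
  proof (cases "0 \<le> m")
    case True
    then show ?thesis using nat[of i "nat m"] by simp
  next
    case False
    then show ?thesis using nat[of "i + int s * m" "nat (- m)"] by (simp add: algebra_simps)
  qed
qed

lemma bezout_rep:
  fixes x :: int
  assumes "coprime s t"
  obtains i k where "x = int t * i - int s * k"
proof -
  have "gcd (int t) (int s) = 1" using assms by (simp add: gcd.commute)
  then obtain u v where "u * int t + v * int s = 1" using bezout_int[of "int t" "int s"] by auto
  then have "x * (u * int t + v * int s) = x" by simp
  then have "x = int t * (u * x) - int s * (- (v * x))" by (simp add: algebra_simps)
  then show thesis using that by blast
qed

lemma rep_eqE:
  assumes "coprime s t" "0 < s" "int t * i - int s * k = int t * i' - int s * k'"
  obtains m where "i' = i + int s * m" "k' = k + int t * m"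
proof -
  have eq: "int t * (i' - i) = int s * (k' - k)" using assms(3) by (simp add: algebra_simps)
  then have "int s dvd int t * (i' - i)" by simp
  then have "int s dvd i' - i" using assms(1) by (simp add: coprime_dvd_mult_right_iff)
  then obtain m where m: "i' - i = int s * m" by blast
  then have "int s * (k' - k) = int s * (int t * m)" using eq by (simp add: algebra_simps)
  then have "k' - k = int t * m" using assms(2) by simp
  then show thesis using that[of m] m by (simp add: algebra_simps)
qed

lemma ex_threshold:
  fixes P :: "int \<Rightarrow> bool"
  assumes up: "\<And>k. P k \<Longrightarrow> P (k + 1)" and ex: "P k0" and bd: "\<And>k. P k \<Longrightarrow> B \<le> k"
  shows "\<exists>h. \<forall>k. P k \<longleftrightarrow> h \<le> k"
proof -
  define n where "n = (LEAST n. P (B + int n))"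
  have "P (B + int (nat (k0 - B)))" using ex bd[OF ex] by simp
  then have n: "P (B + int n)" unfolding n_def by (rule LeastI)
  have "P k \<longleftrightarrow> B + int n \<le> k" for k
  proof
    assume k: "P k"
    then have "P (B + int (nat (k - B)))" using bd by simp
    then have "n \<le> nat (k - B)" unfolding n_def by (rule Least_le)
    then show "B + int n \<le> k" using bd[OF k] by linarith
  next
    assume "B + int n \<le> k"
    then show "P k" by (induction k rule: int_ge_induct) (use n up in auto)
  qed
  then show ?thesis by blast
qed

text \<open>
  A doubled set contains every sufficiently small integer and none that is sufficiently large, so that
  each residue class modulo \<open>s\<close> has a largest member.
\<close>

lemma ex_profile:
  assumes s: "0 < s" and L: "finite L" and c: "closed_under_sub s (doubled_set L)"
  obtains h where "profile s t (doubled_set L) h"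
proof -
  let ?X = "doubled_set L"
  define M where "M = int (Max (insert 0 L))"
  have M: "int n \<le> M" if "n \<in> L" for n using that L by (simp add: M_def)
  have "0 \<le> M" by (simp add: M_def)
  have above: "x \<le> M" if "x \<in> ?X" for x
    using that M[of "nat x"] \<open>0 \<le> M\<close> by (auto simp: doubled_set_def)
  have below: "x \<in> ?X" if "x < - M" for x
    using that M[of "nat (- x)"] \<open>0 \<le> M\<close> by (auto simp: doubled_set_def)
  have "\<exists>h. \<forall>k. int t * i - int s * k \<in> ?X \<longleftrightarrow> h \<le> k" for i
  proof (rule ex_threshold)
    show "int t * i - int s * (k + 1) \<in> ?X" if "int t * i - int s * k \<in> ?X" for k
      using c that unfolding closed_under_sub_def by (fastforce simp: algebra_simps)
    \<comment> \<open>Beyond \<open>?a\<close> in absolute value, \<open>s k\<close> outweighs \<open>t i\<close> by more than \<open>M\<close>.\<close>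
    let ?a = "\<bar>int t * i\<bar> + M + 1"
    have mul: "k \<le> int s * k" if "0 \<le> k" for k
      using s that mult_right_mono[of 1 "int s" k] by simp
    show "int t * i - int s * ?a \<in> ?X"
      by (rule below) (use mul[of ?a] \<open>0 \<le> M\<close> in linarith)
    show "- ?a \<le> k" if "int t * i - int s * k \<in> ?X" for k
    proof (rule ccontr)
      assume "\<not> - ?a \<le> k"
      then have "- k \<le> int s * (- k)" "?a < - k" using mul[of "- k"] \<open>0 \<le> M\<close> by linarith+
      then show False using above[OF that] by simp
    qed
  qed
  then obtain h where "\<And>i k. int t * i - int s * k \<in> ?X \<longleftrightarrow> h i \<le> k" by metis
  then show thesis using that unfolding profile_def by blast
qed

lemma admissible_of_profile:
  assumes st: "coprime s t" "0 < s" and L: "L \<in> core_sets s t"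
    and h: "profile s t (doubled_set L) h"
  shows "admissible s t h"
proof -
  let ?X = "doubled_set L"
  have cs: "x - int s \<in> ?X" and ct: "x - int t \<in> ?X" if "x \<in> ?X" for x
    using that L by (auto simp: core_sets_def closed_under_sub_def)
  have mem: "int t * i - int s * k \<in> ?X \<longleftrightarrow> h i \<le> k" for i k
    using h unfolding profile_def by blast
  have "h i \<le> h (i + 1)" for i
    using ct[of "int t * (i + 1) - int s * h (i + 1)"] mem[of "i + 1" "h (i + 1)"]
      mem[of i "h (i + 1)"] by (simp add: algebra_simps)
  moreover have "h (i + int s) = h i + int t" for i
  proof -
    have "h (i + int s) \<le> k \<longleftrightarrow> h i + int t \<le> k" for k
      using mem[of "i + int s" k] mem[of i "k - int t"] by (simp add: algebra_simps)
    then show ?thesis by (meson order_antisym order_refl)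
  qed
  moreover have "h 0 = 1"
  proof -
    have "int s \<notin> ?X" using cs[of "int s"] by auto
    then have "- int s \<in> ?X" using st(2) uminus_mem_doubled_set_iff[of "int s" L] by simp
    then show ?thesis using mem[of 0 1] mem[of 0 0] by simp
  qed
  moreover have "h i + h (- i) = 1" if i: "\<not> int s dvd i" for i
  proof -
    have "h i \<le> k \<longleftrightarrow> 1 - h (- i) \<le> k" for k
    proof -
      have "int t * i - int s * k \<noteq> 0"
      proof
        assume "int t * i - int s * k = 0"
        then have "int s dvd int t * i" by (metis dvd_triv_left eq_iff_diff_eq_0)
        then show False using i st(1) by (simp add: coprime_dvd_mult_right_iff)
      qed
      then show ?thesis
        using uminus_mem_doubled_set_iff[of "int t * i - int s * k" L] mem[of i k]
          mem[of "- i" "- k"] by simp linarith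
    qed
    then show ?thesis by (metis add_diff_cancel_left' diff_add_cancel order_antisym order_refl)
  qed
  ultimately show ?thesis by (simp add: admissible_def)
qed

text \<open>
  The converse of \<open>admissible_of_profile\<close>. Finiteness of the set of parts uses representatives
  \<open>0 \<le> i < s\<close>: there \<open>h i \<ge> h 0 = 1\<close>, which bounds \<open>t i - s k\<close> by \<open>t s\<close>.
\<close>

lemma core_set_of_admissible:
  assumes st: "coprime s t" "0 < s" "0 < t" and h: "admissible s t h"
  obtains L where "L \<in> core_sets s t" "profile s t (doubled_set L) h"
proof -
  define X where "X = {int t * i - int s * k | i k. h i \<le> k}"
  have mem: "int t * i - int s * k \<in> X \<longleftrightarrow> h i \<le> k" for i k
  proof
    assume "int t * i - int s * k \<in> X"
    then obtain i' k' where e: "int t * i - int s * k = int t * i' - int s * k'" "h i' \<le> k'"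
      by (auto simp: X_def)
    obtain m where "i' = i + int s * m" "k' = k + int t * m" using rep_eqE[OF st(1,2) e(1)] .
    then show "h i \<le> k" using e(2) admissible_periodic[OF h, of i m] by simp
  qed (auto simp: X_def)
  define L where "L = {n. 0 < n \<and> int n \<in> X}"
  have "n \<le> t * s" if "n \<in> L" for n
  proof -
    obtain i0 k0 where e0: "int n = int t * i0 - int s * k0" using bezout_rep[OF st(1)] .
    define i k where "i = i0 mod int s" and "k = k0 - int t * (i0 div int s)"
    have "i0 = i + int s * (i0 div int s)" by (simp add: i_def)
    then have e: "int n = int t * i - int s * k"
      unfolding e0 k_def by (metis (no_types, opaque_lifting) add_diff_cancel_right' diff_diff_eq2 distrib_left mult.left_commute right_diff_distrib')
    have i: "0 \<le> i" "i < int s" using st(2) by (simp_all add: i_def)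
    have "h i \<le> k" using that mem[of i k] by (simp add: L_def e)
    then have "0 \<le> k" using admissible_mono[OF h i(1)] admissibleD(3)[OF h] by linarith
    then have "0 \<le> int s * k" by simp
    moreover have "int t * i \<le> int t * int s" using i by (intro mult_left_mono) auto
    ultimately have "int n \<le> int (t * s)" unfolding e by simp
    then show ?thesis by linarith
  qed
  then have fin: "finite L" by (meson finite_nat_set_iff_bounded_le)
  have D: "doubled_set L = X"
  proof (rule set_eqI)
    fix x
    show "x \<in> doubled_set L \<longleftrightarrow> x \<in> X"
    proof (cases x "0 :: int" rule: linorder_cases)
      case equal
      then show ?thesis using mem[of 0 0] admissibleD(3)[OF h] by simp
    next
      case greater
      then show ?thesis by (auto simp: doubled_set_def L_def)
    next
      case less
      have "x \<in> X \<longleftrightarrow> - x \<notin> X"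
      proof -
        obtain i k where x: "x = int t * i - int s * k" using bezout_rep[OF st(1)] .
        show ?thesis
        proof (cases "int s dvd i")
          case True
          then obtain c where c: "i = int s * c" by blast
          define k' where "k' = k - int t * c"
          have x': "x = int t * 0 - int s * k'" unfolding x c k'_def by (simp add: algebra_simps)
          then have "0 < int s * k'" using less by simp
          then have "0 < k'" using st(2) by (simp add: zero_less_mult_iff)
          then show ?thesis
            using x' mem[of 0 k'] mem[of 0 "- k'"] admissibleD(3)[OF h] by simp
        next
          case False
          then show ?thesis
            using x mem[of i k] mem[of "- i" "- k"] admissibleD(4)[OF h False] by simp linarith
        qed
      qed
      then show ?thesis using less by (auto simp: doubled_set_def L_def)
    qed
  qed
  have "closed_under_sub s X" unfolding closed_under_sub_def
  proof
    fix x assume "x \<in> X"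
    then obtain i k where "x = int t * i - int s * k" "h i \<le> k" by (auto simp: X_def)
    then have "x - int s = int t * i - int s * (k + 1)" "h i \<le> k + 1" by (simp_all add: algebra_simps)
    then show "x - int s \<in> X" using mem by simp
  qed
  moreover have "closed_under_sub t X" unfolding closed_under_sub_def
  proof
    fix x assume "x \<in> X"
    then obtain i k where "x = int t * i - int s * k" "h i \<le> k" by (auto simp: X_def)
    then have "x - int t = int t * (i - 1) - int s * k" "h (i - 1) \<le> k"
      using admissibleD(1)[OF h, of "i - 1"] by (simp_all add: algebra_simps)
    then show "x - int t \<in> X" using mem by simp
  qed
  ultimately have "L \<in> core_sets s t" using fin D by (simp add: core_sets_def L_def)
  moreover have "profile s t (doubled_set L) h" using mem D by (simp add: profile_def)
  ultimately show thesis using that by blast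
qed

section \<open>Weakly increasing lists with bounded entries\<close>

definition bounded_sorted_lists :: "nat \<Rightarrow> nat \<Rightarrow> nat list set" where
  "bounded_sorted_lists n N = {xs. length xs = n \<and> sorted xs \<and> set xs \<subseteq> {1..N}}"

lemma finite_bounded_sorted_lists: "finite (bounded_sorted_lists n N)"
  by (rule finite_subset[OF _ finite_lists_length_eq[of "{1..N}" n]])
    (auto simp: bounded_sorted_lists_def)

text \<open>
  A list starts with the smallest admissible entry, or else all entries can be lowered by one.
\<close>

lemma bounded_sorted_lists_rec:
  "bounded_sorted_lists (Suc n) (Suc N) =
    (#) 1 ` bounded_sorted_lists n (Suc N) \<union> map Suc ` bounded_sorted_lists (Suc n) N"
proof (intro equalityI subsetI)
  fix xs assume xs: "xs \<in> bounded_sorted_lists (Suc n) (Suc N)"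
  then obtain x ys where eq: "xs = x # ys" by (cases xs) (auto simp: bounded_sorted_lists_def)
  show "xs \<in> (#) 1 ` bounded_sorted_lists n (Suc N) \<union> map Suc ` bounded_sorted_lists (Suc n) N"
  proof (cases "x = 1")
    case True
    then have "ys \<in> bounded_sorted_lists n (Suc N)"
      using xs eq by (simp add: bounded_sorted_lists_def)
    then show ?thesis using True eq by simp
  next
    case False
    then have "2 \<le> x" using xs eq by (auto simp: bounded_sorted_lists_def)
    moreover have "sorted (x # ys)" using xs eq by (simp add: bounded_sorted_lists_def)
    ultimately have ge: "2 \<le> y" if "y \<in> set xs" for y
      using that unfolding eq by (auto intro: order_trans)
    have "map Suc (map (\<lambda>y. y - 1) xs) = xs"
      unfolding map_map by (rule map_idI) (use ge in force)
    moreover have "map (\<lambda>y. y - 1) xs \<in> bounded_sorted_lists (Suc n) N"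
    proof -
      have "sorted (map (\<lambda>y. y - 1) xs)"
        using xs unfolding bounded_sorted_lists_def sorted_wrt_map
        by (auto intro: sorted_wrt_mono_rel[of xs "(\<le>)"] diff_le_mono)
      moreover have "y - 1 \<in> {1..N}" if "y \<in> set xs" for y
        using ge[OF that] xs that by (auto simp: bounded_sorted_lists_def)
      ultimately show ?thesis using xs by (auto simp: bounded_sorted_lists_def)
    qed
    ultimately show ?thesis by (metis UnI2 image_eqI)
  qed
next
  fix xs assume "xs \<in> (#) 1 ` bounded_sorted_lists n (Suc N) \<union> map Suc ` bounded_sorted_lists (Suc n) N"
  then show "xs \<in> bounded_sorted_lists (Suc n) (Suc N)"
  proof
    assume "xs \<in> map Suc ` bounded_sorted_lists (Suc n) N"
    then obtain ys where ys: "xs = map Suc ys" "ys \<in> bounded_sorted_lists (Suc n) N" by blast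
    then have "sorted xs" by (simp add: bounded_sorted_lists_def sorted_wrt_map)
    then show ?thesis using ys by (auto simp: bounded_sorted_lists_def)
  qed (auto simp: bounded_sorted_lists_def subset_iff)
qed

lemma card_bounded_sorted_lists:
  "card (bounded_sorted_lists n (Suc N)) = (n + N) choose n"
proof (induction "n + N" arbitrary: n N)
  case 0
  have "bounded_sorted_lists 0 (Suc 0) = {[]}" by (auto simp: bounded_sorted_lists_def)
  then show ?case using 0 by simp
next
  case (Suc k)
  show ?case
  proof (cases n)
    case 0
    have "bounded_sorted_lists 0 (Suc N) = {[]}" by (auto simp: bounded_sorted_lists_def)
    then show ?thesis using 0 by simp
  next
    case n: (Suc n')
    let ?A = "(#) 1 ` bounded_sorted_lists n' (Suc N)"
    let ?B = "map Suc ` bounded_sorted_lists (Suc n') N"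
    have "?A \<inter> ?B = {}" by (auto simp: bounded_sorted_lists_def)
    then have "card (bounded_sorted_lists n (Suc N)) = card ?A + card ?B"
      unfolding n bounded_sorted_lists_rec
      by (intro card_Un_disjoint finite_imageI finite_bounded_sorted_lists)
    also have "card ?A = card (bounded_sorted_lists n' (Suc N))" by (intro card_image) simp
    also have "\<dots> = (n' + N) choose n'" using Suc.hyps n by simp
    also have "card ?B = card (bounded_sorted_lists (Suc n') N)"
      by (intro card_image) (simp add: inj_on_def)
    also have "\<dots> = (n' + N) choose (Suc n')"
    proof (cases N)
      case 0
      have "bounded_sorted_lists (Suc n') 0 = {}" by (auto simp: bounded_sorted_lists_def)
      then show ?thesis using 0 by simp
    next
      case N: (Suc N')
      then show ?thesis using Suc.hyps(1)[of "Suc n'" N'] Suc.hyps(2) n by simp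
    qed
    finally show ?thesis by (simp add: n)
  qed
qed

section \<open>Height functions as weakly increasing lists\<close>

text \<open>
  The reflection combined with one period.
\<close>

lemma admissible_complement:
  assumes "admissible s t h" "0 < i" "i < int s"
  shows "h i + h (int s - i) = int t + 1"
proof -
  have "\<not> int s dvd i" using assms(2,3) by (meson zdvd_not_zless)
  then show ?thesis
    using admissibleD(4)[OF assms(1)] admissibleD(2)[OF assms(1), of "- i"] by (simp add: algebra_simps)
qed

text \<open>
  The values at \<open>i\<close> and \<open>s - i\<close> determine each other, the value at \<open>s / 2\<close> (for even \<open>s\<close>) is forced
  to be \<open>(t + 1) / 2\<close>, and periodicity does the rest.
\<close>

lemma admissible_determined:
  assumes h: "admissible s t h" and g: "admissible s t g" and s: "0 < s"
    and eq: "\<And>i. 1 \<le> i \<Longrightarrow> i \<le> (s - 1) div 2 \<Longrightarrow> h (int i) = g (int i)"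
  shows "h = g"
proof
  fix i
  have small: "h r = g r" if r: "0 \<le> r" "2 * r < int s" for r
  proof (cases "r = 0")
    case True
    then show ?thesis using admissibleD(3) h g by metis
  next
    case False
    then show ?thesis using eq[of "nat r"] r by simp
  qed
  have res: "h r = g r" if r: "0 \<le> r" "r < int s" for r
  proof (cases r "int s - r" rule: linorder_cases)
    case less
    then show ?thesis using small r by simp
  next
    case equal
    then have "0 < r" using r by simp
    from admissible_complement[OF h this r(2)] admissible_complement[OF g this r(2)]
    show ?thesis using equal by simp
  next
    case greater
    then have "0 < r" using r by simp
    from admissible_complement[OF h this r(2)] admissible_complement[OF g this r(2)]
    show ?thesis using small[of "int s - r"] greater r by simp
  qed
  have "h i = h (i mod int s) + int t * (i div int s)" "g i = g (i mod int s) + int t * (i div int s)"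
    using admissible_periodic[OF h, of "i mod int s" "i div int s"]
      admissible_periodic[OF g, of "i mod int s" "i div int s"] by simp_all
  then show "h i = g i" using res[of "i mod int s"] s by simp
qed

text \<open>
  Inverse of restricting an admissible function to \<open>1, \<dots>, (s - 1) div 2\<close>. The list is prefixed with
  the value \<open>1\<close> at index \<open>0\<close>; the cases are the lower half of a period, the upper half, and its centre.
\<close>

definition extend_list :: "nat \<Rightarrow> nat \<Rightarrow> nat list \<Rightarrow> int \<Rightarrow> int" where
  "extend_list s t xs i = (let r = i mod int s; f = (\<lambda>k. int ((1 # xs) ! nat k)) in
     (if 2 * r < int s then f r else if int s < 2 * r then int t + 1 - f (int s - r)
      else (int t + 1) div 2) + int t * (i div int s))"

text \<open>
  Monotonicity is delicate only where the two halves meet, and there the bound \<open>(t + 1) div 2\<close> on the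
  entries is exactly what is needed. At the centre, which exists only for even \<open>s\<close>, coprimality makes
  \<open>t\<close> odd, so that \<open>(t + 1) / 2\<close> is an integer and the reflection holds.
\<close>

lemma admissible_extend_list:
  assumes st: "coprime s t" "0 < s" "0 < t"
    and xs: "xs \<in> bounded_sorted_lists ((s - 1) div 2) ((t + 1) div 2)"
  shows "admissible s t (extend_list s t xs)"
proof -
  define f where "f k = int ((1 # xs) ! nat k)" for k
  define g where "g r = (if 2 * r < int s then f r
    else if int s < 2 * r then int t + 1 - f (int s - r) else (int t + 1) div 2)" for r
  define h where "h = extend_list s t xs"
  have h: "h i = g (i mod int s) + int t * (i div int s)" for i
    by (simp add: h_def extend_list_def g_def f_def Let_def)
  have len: "length xs = (s - 1) div 2" and sorted: "sorted (1 # xs)"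
    and range: "set (1 # xs) \<subseteq> {1..(t + 1) div 2}"
    using xs st by (auto simp: bounded_sorted_lists_def)
  have f0: "f 0 = 1" by (simp add: f_def)
  have f_bounds: "1 \<le> f k \<and> 2 * f k \<le> int t + 1" if "0 \<le> k" "2 * k < int s" for k
  proof -
    have "(1 # xs) ! nat k \<in> set (1 # xs)" using that len by (intro nth_mem) auto
    then have "(1 # xs) ! nat k \<in> {1..(t + 1) div 2}" using range by blast
    then show ?thesis unfolding f_def by auto
  qed
  have f_mono: "f k \<le> f m" if "0 \<le> k" "k \<le> m" "2 * m < int s" for k m
    unfolding f_def of_nat_le_iff
    by (rule sorted_nth_mono[OF sorted]) (use that len in auto)
  have odd: "2 * ((int t + 1) div 2) = int t + 1" if "even s"
  proof -
    have "odd t" using that st(1) by (metis coprime_common_divisor odd_one)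
    then show ?thesis by (elim oddE) simp
  qed
  have g0: "g 0 = 1" using st f0 by (simp add: g_def)
  have g_compl: "g r + g (int s - r) = int t + 1" if "0 < r" "r < int s" for r
  proof (cases "2 * r" "int s" rule: linorder_cases)
    case equal
    then have "even (int s)" by (metis dvd_triv_left)
    then show ?thesis using equal odd by (simp add: g_def)
  qed (simp_all add: g_def)
  have g_mono: "g r \<le> g (r + 1)" if r: "0 \<le> r" "r + 1 < int s" for r
  proof (cases "2 * r" "int s" rule: linorder_cases)
    case less
    then have "2 * (r + 1) < int s \<or> 2 * (r + 1) = int s \<or> 2 * r + 1 = int s" by presburger
    then consider "2 * (r + 1) < int s" | "2 * (r + 1) = int s" | "2 * r + 1 = int s" by blast
    then show ?thesis
    proof cases
      case 1
      then show ?thesis using f_mono[of r "r + 1"] r by (simp add: g_def)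
    next
      case 2
      then have "2 * f r \<le> int t + 1" using f_bounds[of r] r by simp
      then have "f r \<le> (int t + 1) div 2" by presburger
      then show ?thesis using 2 less by (simp add: g_def)
    next
      case 3
      then have mid: "int s - (r + 1) = r" by simp
      have "g (r + 1) = int t + 1 - f (int s - (r + 1))" using 3 by (simp add: g_def)
      then show ?thesis unfolding mid using f_bounds[of r] r 3 by (simp add: g_def)
    qed
  next
    case equal
    then have "2 * f (int s - (r + 1)) \<le> int t + 1" using f_bounds[of "int s - (r + 1)"] r by simp
    then have "(int t + 1) div 2 \<le> int t + 1 - f (int s - (r + 1))" by presburger
    then show ?thesis using equal by (simp add: g_def)
  next
    case greater
    then show ?thesis using f_mono[of "int s - (r + 1)" "int s - r"] r by (simp add: g_def)
  qed
  have g_le: "g r \<le> int t" if "0 \<le> r" "r < int s" for r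
  proof (cases "2 * r" "int s" rule: linorder_cases)
    case less
    then show ?thesis using f_bounds[of r] that st(3) by (simp add: g_def)
  next
    case equal
    then show ?thesis using st(3) by (simp add: g_def)
  next
    case greater
    then show ?thesis using f_bounds[of "int s - r"] that by (simp add: g_def)
  qed
  have "h i \<le> h (i + 1)" for i
  proof (cases "i mod int s + 1 = int s")
    case True
    have "i + 1 = int s * (i div int s + 1)"
      using True mult_div_mod_eq[of "int s" i] by (simp only: distrib_left)
    then have "(i + 1) mod int s = 0" "(i + 1) div int s = i div int s + 1"
      using int_mod_pos_eq[of "i + 1" "int s" "i div int s + 1" 0]
        int_div_pos_eq[of "i + 1" "int s" "i div int s + 1" 0] st(2) by simp_all
    then show ?thesis using g_le[of "i mod int s"] g0 st(2) by (simp add: h algebra_simps)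
  next
    case False
    moreover have "i mod int s < int s" "0 \<le> i mod int s" using st(2) by simp_all
    ultimately have r: "0 \<le> i mod int s" "i mod int s + 1 < int s" by linarith+
    have "i + 1 = int s * (i div int s) + (i mod int s + 1)" "0 \<le> i mod int s + 1"
      using r(1) by simp_all
    then have "(i + 1) mod int s = i mod int s + 1" "(i + 1) div int s = i div int s"
      using int_mod_pos_eq int_div_pos_eq r(2) by blast+
    then show ?thesis using g_mono[OF r] by (simp add: h)
  qed
  moreover have "h (i + int s) = h i + int t" for i
    using st(2) by (simp add: h div_add_self2 algebra_simps)
  moreover have "h 0 = 1" using g0 by (simp add: h)
  moreover have "h i + h (- i) = 1" if i: "\<not> int s dvd i" for i
  proof -
    have nz: "i mod int s \<noteq> 0" using i by (simp add: mod_eq_0_iff_dvd)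
    moreover have "0 \<le> i mod int s" "i mod int s < int s" using st(2) by simp_all
    ultimately have r: "0 < i mod int s" "i mod int s < int s" by linarith+
    have minus: "(- i) mod int s = int s - i mod int s" "(- i) div int s = - (i div int s) - 1"
      using nz st(2) by (simp_all add: zmod_zminus1_eq_if zdiv_zminus1_eq_if)
    show ?thesis using g_compl[OF r] unfolding h minus by (simp add: right_diff_distrib)
  qed
  ultimately show ?thesis unfolding h_def[symmetric] by (simp add: admissible_def)
qed

definition heights :: "nat \<Rightarrow> nat \<Rightarrow> nat set \<Rightarrow> int \<Rightarrow> int" where
  "heights s t L = (SOME h. profile s t (doubled_set L) h)"

definition height_list :: "nat \<Rightarrow> nat \<Rightarrow> nat set \<Rightarrow> nat list" where
  "height_list s t L = map (\<lambda>i. nat (heights s t L (int i))) [1..<Suc ((s - 1) div 2)]"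

lemma profile_unique:
  assumes "profile s t X h" "profile s t X g"
  shows "h = g"
proof
  fix i
  have "h i \<le> k \<longleftrightarrow> g i \<le> k" for k using assms unfolding profile_def by blast
  then show "h i = g i" by (meson order_antisym order_refl)
qed

lemma set_eq_of_profile:
  assumes "coprime s t" "profile s t X h" "profile s t Y h"
  shows "X = Y"
proof (rule set_eqI)
  fix x
  obtain i k where "x = int t * i - int s * k" using bezout_rep[OF assms(1)] .
  then show "x \<in> X \<longleftrightarrow> x \<in> Y" using assms(2,3) by (simp add: profile_def)
qed

lemma doubled_set_inj:
  assumes "0 \<notin> L" "0 \<notin> M" "doubled_set L = doubled_set M"
  shows "L = M"
proof (rule set_eqI)
  show "n \<in> L \<longleftrightarrow> n \<in> M" for n
    using assms by (metis doubled_set_simps(2) neq0_conv)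
qed

lemma profile_heights:
  assumes "0 < s" "L \<in> core_sets s t"
  shows "profile s t (doubled_set L) (heights s t L)"
proof -
  obtain h where "profile s t (doubled_set L) h"
    using ex_profile[OF assms(1)] assms(2) unfolding core_sets_def by blast
  then show ?thesis unfolding heights_def by (rule someI[of "profile s t (doubled_set L)"])
qed

text \<open>
  The upper bound comes from \<open>h i \<le> h (s - i) = t + 1 - h i\<close>.
\<close>

lemma admissible_half_bound:
  assumes h: "admissible s t h" and s: "0 < s" and t: "0 < t" and i: "i \<le> (s - 1) div 2"
  shows "1 \<le> h (int i)" "h (int i) \<le> int ((t + 1) div 2)"
proof -
  show "1 \<le> h (int i)" using admissible_mono[OF h, of 0 "int i"] admissibleD(3)[OF h] by simp
  show "h (int i) \<le> int ((t + 1) div 2)"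
  proof (cases "i = 0")
    case True
    then show ?thesis using admissibleD(3)[OF h] t by simp
  next
    case False
    have "int i \<le> int s - int i" "int i < int s" using i s by linarith+
    then show ?thesis
      using admissible_complement[OF h, of "int i"] admissible_mono[OF h, of "int i" "int s - int i"] False
      by simp
  qed
qed

lemma nth_height_list:
  assumes "k < (s - 1) div 2"
  shows "height_list s t L ! k = nat (heights s t L (int (Suc k)))"
  using assms by (simp add: height_list_def del: upt_Suc)

lemma length_height_list: "length (height_list s t L) = (s - 1) div 2"
  by (simp add: height_list_def)

lemma set_height_list:
  "set (height_list s t L) = (\<lambda>i. nat (heights s t L (int i))) ` {1..(s - 1) div 2}"
  by (simp add: height_list_def atLeastLessThanSuc_atLeastAtMost del: upt_Suc)

lemma bij_betw_height_list:
  assumes st: "coprime s t" "0 < s" "0 < t"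
  shows "bij_betw (height_list s t) (core_sets s t)
    (bounded_sorted_lists ((s - 1) div 2) ((t + 1) div 2))"
proof (rule bij_betw_imageI)
  let ?n = "(s - 1) div 2"
  note prof = profile_heights[OF st(2)]
  have adm: "admissible s t (heights s t L)" if "L \<in> core_sets s t" for L
    by (rule admissible_of_profile[OF st(1,2) that prof[OF that]])
  show "inj_on (height_list s t) (core_sets s t)"
  proof (rule inj_onI)
    fix L M assume LM: "L \<in> core_sets s t" "M \<in> core_sets s t" and eq: "height_list s t L = height_list s t M"
    have "heights s t L = heights s t M"
    proof (rule admissible_determined[OF adm[OF LM(1)] adm[OF LM(2)] st(2)])
      fix i assume i: "1 \<le> i" "i \<le> ?n"
      then have "nat (heights s t L (int i)) = nat (heights s t M (int i))"
        using eq nth_height_list[of "i - 1" s t L] nth_height_list[of "i - 1" s t M] by simp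
      then show "heights s t L (int i) = heights s t M (int i)"
        using admissible_half_bound(1)[OF adm[OF LM(1)] st(2,3) i(2)]
          admissible_half_bound(1)[OF adm[OF LM(2)] st(2,3) i(2)] by simp
    qed
    then have "doubled_set L = doubled_set M"
      using set_eq_of_profile[OF st(1) prof[OF LM(1)]] prof[OF LM(2)] by simp
    then show "L = M" using LM by (intro doubled_set_inj) (auto simp: core_sets_def)
  qed
  show "height_list s t ` core_sets s t = bounded_sorted_lists ?n ((t + 1) div 2)"
  proof (intro equalityI subsetI)
    fix xs assume "xs \<in> height_list s t ` core_sets s t"
    then obtain L where L: "L \<in> core_sets s t" "xs = height_list s t L" by blast
    note b = admissible_half_bound[OF adm[OF L(1)] st(2,3)]
    have "sorted xs"
      unfolding sorted_iff_nth_mono_less L(2) length_height_list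
    proof (intro allI impI)
      fix a c assume "a < c" "c < ?n"
      then show "height_list s t L ! a \<le> height_list s t L ! c"
        using admissible_mono[OF adm[OF L(1)], of "int (Suc a)" "int (Suc c)"]
        by (simp add: nth_height_list)
    qed
    moreover have "x \<in> {1..(t + 1) div 2}" if x: "x \<in> set xs" for x
    proof -
      obtain i where "1 \<le> i" "i \<le> ?n" "x = nat (heights s t L (int i))"
        using x unfolding L(2) set_height_list by auto
      then show ?thesis using b[of i] by (simp add: nat_le_iff le_nat_iff)
    qed
    ultimately show "xs \<in> bounded_sorted_lists ?n ((t + 1) div 2)"
      using L(2) length_height_list by (auto simp: bounded_sorted_lists_def)
  next
    fix xs assume xs: "xs \<in> bounded_sorted_lists ?n ((t + 1) div 2)"
    then obtain L where L: "L \<in> core_sets s t" "profile s t (doubled_set L) (extend_list s t xs)"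
      using core_set_of_admissible[OF st admissible_extend_list[OF st xs]] by blast
    have h: "heights s t L = extend_list s t xs" by (rule profile_unique[OF prof[OF L(1)] L(2)])
    have len: "length xs = ?n" using xs by (simp add: bounded_sorted_lists_def)
    have "height_list s t L = xs"
    proof (rule nth_equalityI)
      fix k assume "k < length (height_list s t L)"
      then have k: "k < ?n" by (simp add: length_height_list)
      then have "2 * (1 + k) < s" by presburger
      then have "2 * (1 + int k) < int s" by presburger
      then have "extend_list s t xs (int (Suc k)) = int (xs ! k)"
        by (simp add: extend_list_def nat_add_distrib)
      then show "height_list s t L ! k = xs ! k" by (simp add: nth_height_list[OF k] h)
    qed (simp add: length_height_list len)
    then show "xs \<in> height_list s t ` core_sets s t" using L(1) by blast
  qed
qed

lemma card_core_sets:
  assumes "coprime s t" "0 < s" "0 < t"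
  shows "finite (core_sets s t)"
    and "card (core_sets s t) = ((s - 1) div 2 + (t - 1) div 2) choose ((s - 1) div 2)"
proof -
  note b = bij_betw_height_list[OF assms]
  show "finite (core_sets s t)" using bij_betw_finite[OF b] finite_bounded_sorted_lists by blast
  have "(t + 1) div 2 = Suc ((t - 1) div 2)" using assms(3) by (cases t) auto
  then show "card (core_sets s t) = ((s - 1) div 2 + (t - 1) div 2) choose ((s - 1) div 2)"
    using bij_betw_same_card[OF b] card_bounded_sorted_lists by simp
qed

text \<open>
  Since \<open>m - t = t (m - 1) - s b\<close>, the extra condition bounds the last entry of the height list by \<open>b\<close>
  instead of \<open>b + 1\<close>. For \<open>m = 1\<close> the list is empty and the condition reads \<open>h 0 = 1 \<le> b\<close>; this is why
  \<open>b = 0\<close> is a separate case.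
\<close>

lemma card_core_sets_half:
  assumes st: "coprime s t" and s: "s = 2 * m" "0 < m" and t: "t = 2 * b + 1"
  shows "card {L \<in> core_sets s t. int m - int t \<in> doubled_set L} =
    (if b = 0 then 0 else (m - 1 + (b - 1)) choose (m - 1))"
proof -
  have pos: "0 < s" "0 < t" using s t by simp_all
  have n: "(s - 1) div 2 = m - 1" using s by simp
  have rep: "int m - int t = int t * int (m - 1) - int s * int b"
    using s t by (simp add: of_nat_diff algebra_simps)
  have iff: "int m - int t \<in> doubled_set L \<longleftrightarrow> heights s t L (int (m - 1)) \<le> int b"
    if "L \<in> core_sets s t" for L
    unfolding rep using profile_heights[OF pos(1) that] unfolding profile_def by blast
  have adm: "admissible s t (heights s t L)" if "L \<in> core_sets s t" for L
    by (rule admissible_of_profile[OF st pos(1) that profile_heights[OF pos(1) that]])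
  note lower = admissible_half_bound(1)[OF adm pos, unfolded n]
  show ?thesis
  proof (cases "b = 0")
    case True
    have "\<not> heights s t L (int (m - 1)) \<le> int b" if "L \<in> core_sets s t" for L
      using lower[OF that, of "m - 1"] True by simp
    then have "{L \<in> core_sets s t. int m - int t \<in> doubled_set L} = {}" using iff by blast
    then show ?thesis using True by (metis card.empty)
  next
    case False
    have mem: "heights s t L (int (m - 1)) \<le> int b \<longleftrightarrow> height_list s t L \<in> bounded_sorted_lists (m - 1) b"
      if L: "L \<in> core_sets s t" for L
    proof
      assume le: "heights s t L (int (m - 1)) \<le> int b"
      have "x \<in> {1..b}" if x: "x \<in> set (height_list s t L)" for x
      proof -
        obtain i where i: "1 \<le> i" "i \<le> m - 1" "x = nat (heights s t L (int i))"
          using x unfolding set_height_list n by auto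
        have "heights s t L (int i) \<le> int b"
          using admissible_mono[OF adm[OF L] of_nat_mono[OF i(2)]] le by (rule order_trans)
        then show ?thesis using i lower[OF L i(2)] by (simp add: nat_le_iff le_nat_iff)
      qed
      moreover have "height_list s t L \<in> bounded_sorted_lists (m - 1) ((t + 1) div 2)"
        using bij_betwE[OF bij_betw_height_list[OF st pos]] L n by auto
      ultimately show "height_list s t L \<in> bounded_sorted_lists (m - 1) b"
        by (auto simp: bounded_sorted_lists_def)
    next
      assume hl: "height_list s t L \<in> bounded_sorted_lists (m - 1) b"
      show "heights s t L (int (m - 1)) \<le> int b"
      proof (cases "m = 1")
        case True
        then show ?thesis using admissibleD(3)[OF adm[OF L]] False by simp
      next
        case m: False
        then have "height_list s t L ! (m - 2) \<in> set (height_list s t L)"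
          using s n by (intro nth_mem) (simp add: length_height_list)
        moreover have "height_list s t L ! (m - 2) = nat (heights s t L (int (m - 1)))"
          using nth_height_list[of "m - 2" s t L] n m s by (simp add: Suc_diff_Suc numeral_2_eq_2)
        moreover have "set (height_list s t L) \<subseteq> {1..b}" using hl by (simp add: bounded_sorted_lists_def)
        ultimately have "nat (heights s t L (int (m - 1))) \<le> b" by (metis atLeastAtMost_iff subsetD)
        then show ?thesis by linarith
      qed
    qed
    have sub: "bounded_sorted_lists (m - 1) b \<subseteq> bounded_sorted_lists ((s - 1) div 2) ((t + 1) div 2)"
      unfolding n using t by (auto simp: bounded_sorted_lists_def)
    let ?C = "{L \<in> core_sets s t. height_list s t L \<in> bounded_sorted_lists (m - 1) b}"
    have "height_list s t ` ?C = bounded_sorted_lists (m - 1) b \<inter> height_list s t ` core_sets s t"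
      by auto
    also have "\<dots> = bounded_sorted_lists (m - 1) b"
      using sub bij_betw_imp_surj_on[OF bij_betw_height_list[OF st pos]] by (simp add: Int_absorb2)
    finally have "bij_betw (height_list s t) ?C (bounded_sorted_lists (m - 1) b)"
      by (intro bij_betw_subset[OF bij_betw_height_list[OF st pos]]) auto
    moreover have "{L \<in> core_sets s t. int m - int t \<in> doubled_set L} = ?C"
      using iff mem by blast
    ultimately have "bij_betw (height_list s t) {L \<in> core_sets s t. int m - int t \<in> doubled_set L}
        (bounded_sorted_lists (m - 1) b)" by (simp only:)
    from bij_betw_same_card[OF this] show ?thesis
      using card_bounded_sorted_lists[of "m - 1" "b - 1"] False by simp
  qed
qed

section \<open>Bar cores that contain half of an even modulus\<close>

lemma doubled_set_insert:
  assumes "0 < m"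
  shows "doubled_set (insert m L) = insert (int m) (doubled_set L - {- int m})"
  using assms by (auto simp: doubled_set_def)

text \<open>
  Adding the part \<open>m\<close> exchanges \<open>m\<close> and \<open>- m\<close> in the doubled set. Being congruent modulo \<open>s = 2 m\<close>, they
  have the same effect on divisibility by \<open>s\<close> of the differences to other integers, and their own
  difference \<open>m - (- m)\<close> is not among the bar lengths. For closure under \<open>t\<close> the new member \<open>m\<close>
  requires \<open>m - t\<close>, and by antisymmetry \<open>t - m\<close> is then absent, so that the loss of \<open>- m\<close> does no
  harm.
\<close>

lemma half_in_bar_core:
  assumes s: "s = 2 * m" "0 < m" and t: "odd t" and L: "0 \<notin> L" "m \<notin> L"
  shows "bar_core s (insert m L) \<and> closed_under_sub t (doubled_set (insert m L)) \<longleftrightarrow>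
    closed_under_sub s (doubled_set L) \<and> closed_under_sub t (doubled_set L) \<and>
    int m - int t \<in> doubled_set L"
    (is "bar_core s ?M \<and> closed_under_sub t ?Y \<longleftrightarrow> closed_under_sub s ?X \<and> closed_under_sub t ?X \<and> _")
proof -
  have s0: "0 < s" and t0: "0 < t" using s t by (auto intro: odd_pos)
  have Y: "y \<in> ?Y \<longleftrightarrow> y = int m \<or> (y \<in> ?X \<and> y \<noteq> - int m)" for y
    using doubled_set_insert[OF s(2)] by auto
  have mX: "int m \<notin> ?X" "- int m \<in> ?X"
    using L(2) s(2) uminus_mem_doubled_set_iff[of "int m" L] by auto
  have memX: "int n \<in> ?X" if "n \<in> L" for n
    using that L by (metis doubled_set_simps(2) neq0_conv)
  have closed_s: "closed_under_sub s ?X \<longleftrightarrow> bar_core s L"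
    using closed_under_sub_iff_bar_core[OF s0 L(1)] L(2) s(1) by simp
  have even_s: "int s dvd x + int m \<longleftrightarrow> int s dvd x - int m" for x
  proof -
    have "x + int m = (x - int m) + int s" using s by simp
    then show ?thesis by (metis dvd_add_left_iff dvd_refl)
  qed
  show ?thesis
  proof
    assume a: "bar_core s ?M \<and> closed_under_sub t ?Y"
    then have b: "bar_core s ?M" and ct: "\<And>x. x \<in> ?Y \<Longrightarrow> x - int t \<in> ?Y"
      by (auto simp: closed_under_sub_def)
    have "bar_core s L"
      unfolding bar_core_def
    proof (intro ballI allI impI notI)
      fix n y assume n: "n \<in> L" and y: "y \<notin> ?X" "- int n < y" "y < int n" "int s dvd int n - y"
      have "y \<in> ?Y" using bar_coreD[OF b, of n y] n y by blast
      then have "y = int m" using Y y(1) by blast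
      then have "- int m \<in> ?Y" using bar_coreD[OF b, of n "- int m"] n y even_s by simp
      then show False using Y s(2) by simp
    qed
    moreover have mt: "int m - int t \<in> ?X" using ct[of "int m"] Y t0 by auto
    moreover have nmt: "int m + int t \<notin> ?X"
    proof
      assume "int m + int t \<in> ?X"
      then have "int (m + t) \<in> ?X" by simp
      then have "m + t \<in> ?M" using s(2) by (simp only: doubled_set_simps) simp
      \<comment> \<open>The difference of \<open>m + t\<close> and \<open>t - m\<close> is \<open>s\<close>.\<close>
      then have "int t - int m \<in> ?Y"
        by (rule bar_coreD[OF b]) (use s t0 in auto)
      then have "- int m \<in> ?Y" using ct[of "int t - int m"] by simp
      then show False using Y s(2) by simp
    qed
    moreover have "closed_under_sub t ?X"
      unfolding closed_under_sub_def
    proof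
      fix x assume x: "x \<in> ?X"
      show "x - int t \<in> ?X"
      proof (cases "x = - int m")
        case True
        then show ?thesis
          using nmt uminus_mem_doubled_set_iff[of "int m + int t" L] s(2) by (simp add: algebra_simps)
      next
        case False
        then have "x - int t \<in> ?Y" using x Y ct by blast
        moreover have "x - int t \<noteq> int m" using nmt x by (auto simp: algebra_simps)
        ultimately show ?thesis using Y by blast
      qed
    qed
    ultimately show "closed_under_sub s ?X \<and> closed_under_sub t ?X \<and> int m - int t \<in> ?X"
      using closed_s by blast
  next
    assume a: "closed_under_sub s ?X \<and> closed_under_sub t ?X \<and> int m - int t \<in> ?X"
    then have ct: "\<And>x. x \<in> ?X \<Longrightarrow> x - int t \<in> ?X" and mt: "int m - int t \<in> ?X"
      by (auto simp: closed_under_sub_def)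
    have b: "bar_core s L" using a closed_s by blast
    have "int m - int t \<noteq> 0" using mt by auto
    then have tm: "int t - int m \<notin> ?X" using uminus_mem_doubled_set_iff[of "int m - int t" L] mt by simp
    have "bar_core s ?M"
      unfolding bar_core_def
    proof (intro ballI allI impI notI)
      fix n y assume n: "n \<in> ?M" and y: "y \<notin> ?Y" "- int n < y" "y < int n" "int s dvd int n - y"
      show False
      proof (cases "n = m")
        case True
        then have "0 < int n - y" "int n - y < int s" using y s by auto
        then show False using y(4) zdvd_not_zless by blast
      next
        case False
        then have nL: "n \<in> L" using n by simp
        have "y \<in> ?X" using bar_coreD[OF b nL] y by blast
        then have "y = - int m" using Y y(1) by blast
        then have "int m \<in> ?X" using bar_coreD[OF b nL, of "int m"] y even_s by simp
        then show False using mX by blast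
      qed
    qed
    moreover have "closed_under_sub t ?Y"
      unfolding closed_under_sub_def
    proof
      fix x assume "x \<in> ?Y"
      then consider "x = int m" | "x \<in> ?X" "x \<noteq> - int m" using Y by blast
      then show "x - int t \<in> ?Y"
      proof cases
        case 1
        have "int t \<noteq> 2 * int m" using t by (metis even_of_nat dvd_triv_left)
        then show ?thesis using 1 mt Y by simp
      next
        case 2
        have "x \<noteq> int t - int m" using 2 tm by blast
        then have "x - int t \<noteq> - int m" by linarith
        then show ?thesis using ct[OF 2(1)] Y by blast
      qed
    qed
    ultimately show "bar_core s ?M \<and> closed_under_sub t ?Y" by blast
  qed
qed

definition bar_core_sets :: "nat \<Rightarrow> nat \<Rightarrow> nat set set" where
  "bar_core_sets s t = {L. finite L \<and> 0 \<notin> L \<and> bar_core s L \<and> bar_core t L}"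

lemma bar_core_sets_odd:
  assumes "odd s" "odd t"
  shows "bar_core_sets s t = core_sets s t"
  using assms closed_under_sub_iff_bar_core odd_pos
  unfolding bar_core_sets_def core_sets_def by auto

text \<open>
  The sets without \<open>m\<close> are the simultaneous cores, those with \<open>m\<close> are counted after deleting \<open>m\<close>.
\<close>

lemma card_bar_core_sets_even:
  assumes st: "coprime s t" and s: "s = 2 * m" "0 < m" and t: "t = 2 * b + 1"
  shows "card (bar_core_sets s t) =
    ((m - 1 + b) choose (m - 1)) + (if b = 0 then 0 else (m - 1 + (b - 1)) choose (m - 1))"
proof -
  have pos: "0 < s" "0 < t" and odd: "odd t" using s t by simp_all
  let ?H = "{L \<in> core_sets s t. int m - int t \<in> doubled_set L}"
  have char_s: "closed_under_sub s (doubled_set L) \<longleftrightarrow> bar_core s L \<and> m \<notin> L" if "0 \<notin> L" for L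
    using closed_under_sub_iff_bar_core[OF pos(1) that] s(1) by simp
  have char_t: "closed_under_sub t (doubled_set L) \<longleftrightarrow> bar_core t L" if "0 \<notin> L" for L
    using closed_under_sub_iff_bar_core[OF pos(2) that] odd by simp
  have core: "L \<in> core_sets s t \<longleftrightarrow> L \<in> bar_core_sets s t \<and> m \<notin> L" for L
    using char_s[of L] char_t[of L] by (auto simp: core_sets_def bar_core_sets_def)
  have half: "insert m L \<in> bar_core_sets s t \<longleftrightarrow> L \<in> ?H" if "m \<notin> L" for L
  proof (cases "0 \<in> L")
    case False
    then have z: "0 \<notin> insert m L" using s(2) by simp
    show ?thesis
      unfolding core_sets_def bar_core_sets_def mem_Collect_eq finite_insert
      using half_in_bar_core[OF s odd False that] char_t[OF z] z False by blast
  qed (auto simp: core_sets_def bar_core_sets_def)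
  have "bar_core_sets s t = core_sets s t \<union> insert m ` ?H"
  proof (intro equalityI subsetI)
    fix L assume L: "L \<in> bar_core_sets s t"
    show "L \<in> core_sets s t \<union> insert m ` ?H"
    proof (cases "m \<in> L")
      case True
      then have eq: "L = insert m (L - {m})" by blast
      then have "L - {m} \<in> ?H" using half[of "L - {m}"] L by simp
      then show ?thesis using eq by (intro UnI2 image_eqI)
    next
      case False
      then show ?thesis using core[of L] L by simp
    qed
  next
    fix L assume "L \<in> core_sets s t \<union> insert m ` ?H"
    then show "L \<in> bar_core_sets s t"
    proof
      assume "L \<in> insert m ` ?H"
      then obtain M where M: "M \<in> ?H" "L = insert m M" by blast
      then have "m \<notin> M" using core[of M] by simp
      then show ?thesis using half[of M] M by blast
    qed (use core[of L] in simp)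
  qed
  moreover have "core_sets s t \<inter> insert m ` ?H = {}" using core by blast
  moreover have fin: "finite (core_sets s t)" by (rule card_core_sets(1)[OF st pos])
  moreover have "card (insert m ` ?H) = card ?H"
  proof (rule card_image, rule inj_onI)
    fix L M assume "L \<in> ?H" "M \<in> ?H" and eq: "insert m L = insert m M"
    then have "m \<notin> L" "m \<notin> M" using core by simp_all
    then show "L = M" using eq by (simp add: insert_ident)
  qed
  ultimately have "card (bar_core_sets s t) = card (core_sets s t) + card ?H"
    by (simp add: card_Un_disjoint)
  moreover have "(s - 1) div 2 = m - 1" "(t - 1) div 2 = b" using s t by simp_all
  ultimately show ?thesis
    by (simp only: card_core_sets(2)[OF st pos] card_core_sets_half[OF st s t])
qed

section \<open>From sets of parts to partitions\<close>

lemma ex_strict_partition: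
  assumes "finite L" "0 \<notin> L"
  obtains l where "strict_partition l" "set l = L"
proof -
  have "sorted_wrt (>) (rev (sorted_list_of_set L))"
    by (simp add: sorted_wrt_rev strict_sorted_list_of_set)
  moreover have "set (rev (sorted_list_of_set L)) = L" using assms(1) by simp
  ultimately show thesis using that assms(2) unfolding strict_partition_def by (metis neq0_conv)
qed

lemma strict_partition_eqI:
  assumes "strict_partition l" "strict_partition k" "set l = set k"
  shows "l = k"
proof -
  have "sorted_wrt (<) (rev l)" "sorted_wrt (<) (rev k)"
    using assms by (simp_all add: strict_partition_def sorted_wrt_rev)
  then have "rev l = rev k" using assms(3) strict_sorted_equal by (metis set_rev)
  then show ?thesis by simp
qed

lemma zero_notin_strict_partition: "strict_partition l \<Longrightarrow> 0 \<notin> set l"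
  by (auto simp: strict_partition_def)

lemma bij_betw_CS: "bij_betw set (CS s t) (bar_core_sets s t)"
proof (rule bij_betw_imageI)
  have csyd: "csyd r l \<longleftrightarrow> strict_partition l \<and> bar_core r (set l)" for r l
    using csyd_iff[of l r] unfolding bar_core_def by (cases "strict_partition l") (auto simp: csyd_def)
  show "inj_on set (CS s t)"
    by (rule inj_onI) (auto simp: CS_def csyd intro: strict_partition_eqI)
  show "set ` CS s t = bar_core_sets s t"
  proof (intro equalityI subsetI)
    fix L assume "L \<in> bar_core_sets s t"
    then have L: "finite L" "0 \<notin> L" "bar_core s L" "bar_core t L" by (auto simp: bar_core_sets_def)
    obtain l where l: "strict_partition l" "set l = L" using ex_strict_partition[OF L(1,2)] .
    then have "l \<in> CS s t" using L csyd by (simp add: CS_def)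
    then show "L \<in> set ` CS s t" using l(2) by blast
  qed (auto simp: CS_def csyd bar_core_sets_def zero_notin_strict_partition)
qed

lemma core_double_iff:
  assumes "is_double_of l p" "0 < s"
  shows "core s p \<longleftrightarrow> closed_under_sub s (doubled_set (set l))"
proof -
  have "is_partition p" using assms(1) by (simp add: is_double_of_def)
  then show ?thesis
    using core_iff_beta_set[of p s] beta_set_double[OF assms(1)] closed_under_sub_iff[OF assms(2)]
    by simp
qed

text \<open>
  The first row of the Frobenius symbol recovers the strict partition.
\<close>

lemma bij_betw_DD:
  assumes "0 < s" "0 < t"
  shows "bij_betw (\<lambda>p. set (fst (frobenius_symbol p))) (DD s t) (core_sets s t)"
proof (rule bij_betw_imageI)
  have frob: "fst (frobenius_symbol p) = l" if "is_double_of l p" for l p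
    using that by (simp add: is_double_of_def)
  have DD: "p \<in> DD s t \<longleftrightarrow> is_double_of (fst (frobenius_symbol p)) p \<and>
      set (fst (frobenius_symbol p)) \<in> core_sets s t" for p
  proof -
    have "0 \<notin> set l" if "is_double_of l p" for l p
      using that zero_notin_strict_partition by (simp add: is_double_of_def)
    then show ?thesis
      using core_double_iff[OF _ assms(1)] core_double_iff[OF _ assms(2)] frob
      unfolding DD_def doubled_distinct_def core_sets_def mem_Collect_eq
      by (metis (lifting) List.finite_set)
  qed
  show "inj_on (\<lambda>p. set (fst (frobenius_symbol p))) (DD s t)"
  proof (rule inj_onI)
    fix p q assume "p \<in> DD s t" "q \<in> DD s t"
      and eq: "set (fst (frobenius_symbol p)) = set (fst (frobenius_symbol q))"
    then have d: "is_double_of (fst (frobenius_symbol p)) p" "is_double_of (fst (frobenius_symbol q)) q"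
      using DD by blast+
    then have "fst (frobenius_symbol p) = fst (frobenius_symbol q)"
      using eq strict_partition_eqI unfolding is_double_of_def by blast
    then show "p = q" using d double_unique by metis
  qed
  show "(\<lambda>p. set (fst (frobenius_symbol p))) ` DD s t = core_sets s t"
  proof (intro equalityI subsetI)
    fix L assume L: "L \<in> core_sets s t"
    then obtain l where l: "strict_partition l" "set l = L"
      using ex_strict_partition[of L] by (auto simp: core_sets_def)
    obtain p where "is_double_of l p" using ex_double[OF l(1)] .
    then have "p \<in> DD s t" "set (fst (frobenius_symbol p)) = L" using DD frob l(2) L by auto
    then show "L \<in> (\<lambda>p. set (fst (frobenius_symbol p))) ` DD s t" by blast
  qed (use DD in auto)
qed

lemma CS_commute: "CS s t = CS t s"
  by (auto simp: CS_def)

text \<open>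
  The two summands of the formula count the sets with and without the part \<open>s / 2\<close>, in this order. The
  convention for negative upper arguments is needed for \<open>s = 2\<close>, \<open>t = 1\<close>, where no set has the part \<open>1\<close>.
\<close>

lemma card_CS_even:
  assumes st: "coprime s t" and s: "even s" "0 < s"
  shows "card (CS s t) = int_binomial (int ((s - 1) div 2) + int (t div 2) - 1) ((s - 1) div 2)
    + int_binomial (int (s div 2) + int ((t - 1) div 2) - 1) ((t - 1) div 2)"
proof -
  obtain m where m: "s = 2 * m" "0 < m" using s by auto
  have "odd t" using s(1) st by (metis coprime_common_divisor odd_one)
  then obtain b where b: "t = 2 * b + 1" by (elim oddE)
  obtain n where n: "m = Suc n" using m(2) by (cases m) auto
  have "card (CS s t) = (n + b choose n) + (if b = 0 then 0 else (n + (b - 1)) choose n)"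
    using bij_betw_same_card[OF bij_betw_CS] card_bar_core_sets_even[OF st m b] n by simp
  moreover have "(n + b) choose n = (n + b) choose b"
    using binomial_symmetric[of n "n + b"] by simp
  moreover have "int_binomial (int n + int b - 1) n = (if b = 0 then 0 else (n + (b - 1)) choose n)"
  proof (cases b)
    case 0
    have "nat (int n - 1) < n" if "0 < n" using that by simp
    then show ?thesis using 0 by (auto simp: int_binomial_def intro!: binomial_eq_0)
  qed (simp add: int_binomial_def nat_add_distrib)
  moreover have "int_binomial (int m + int b - 1) b = (n + b) choose b"
    using n by (simp add: int_binomial_def flip: of_nat_add)
  ultimately show ?thesis using m b n by simp
qed

text \<open>
  Pascal's rule for the number of simultaneous cores; it fails for \<open>s = t = 1\<close>, where the binomial
  coefficient is the apex of the triangle.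
\<close>

lemma card_CS_odd:
  assumes st: "coprime s t" "odd s" "odd t" "\<not> (s = 1 \<and> t = 1)"
  shows "card (CS s t) = int_binomial (int ((s - 1) div 2) + int (t div 2) - 1) ((s - 1) div 2)
    + int_binomial (int (s div 2) + int ((t - 1) div 2) - 1) ((t - 1) div 2)"
proof -
  obtain a b where ab: "s = 2 * a + 1" "t = 2 * b + 1" using st(2,3) by (elim oddE)
  then obtain k where k: "a + b = Suc k" using st(4) by (cases "a + b") auto
  then have "int a + int b - 1 = int k" by linarith
  then have "int_binomial (int a + int b - 1) j = k choose j" for j by (simp add: int_binomial_def)
  moreover have "card (CS s t) = (a + b) choose a"
    using bij_betw_same_card[OF bij_betw_CS] bar_core_sets_odd[OF st(2,3)]
      card_core_sets(2)[OF st(1)] ab by simp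
  moreover have "(a + b) choose a = (k choose a) + (k choose b)"
  proof (cases a)
    case 0
    then show ?thesis using k by simp
  next
    case (Suc a')
    then have "k - a' = b" "a' \<le> k" using k by simp_all
    then have "k choose a' = k choose b" using binomial_symmetric[of a' k] by simp
    then show ?thesis using k Suc by simp
  qed
  ultimately show ?thesis using ab by simp
qed

theorem theorem1p1:
  fixes s t :: nat
  assumes "0 < s" and "0 < t" and "coprime s t"
  shows "card (DD s t) = ((s - 1) div 2 + (t - 1) div 2) choose ((s - 1) div 2) \<and>
    (\<not> (s = 1 \<and> t = 1) \<longrightarrow>
      card (CS s t) =
        int_binomial (int ((s - 1) div 2) + int (t div 2) - 1) ((s - 1) div 2)
        + int_binomial (int (s div 2) + int ((t - 1) div 2) - 1) ((t - 1) div 2))"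
proof (intro conjI impI)
  show "card (DD s t) = ((s - 1) div 2 + (t - 1) div 2) choose ((s - 1) div 2)"
    using bij_betw_same_card[OF bij_betw_DD[OF assms(1,2)]] card_core_sets(2)[OF assms(3,1,2)] by simp
next
  assume "\<not> (s = 1 \<and> t = 1)"
  consider "even s" | "even t" | "odd s" "odd t" by blast
  then show "card (CS s t) =
      int_binomial (int ((s - 1) div 2) + int (t div 2) - 1) ((s - 1) div 2)
      + int_binomial (int (s div 2) + int ((t - 1) div 2) - 1) ((t - 1) div 2)"
  proof cases
    case 1
    then show ?thesis using card_CS_even assms by blast
  next
    case 2
    have "card (CS s t) = card (CS t s)" by (simp add: CS_commute)
    then show ?thesis
      using card_CS_even[of t s] 2 assms by (simp add: coprime_commute add.commute)
  next
    case 3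
    then show ?thesis using card_CS_odd assms \<open>\<not> (s = 1 \<and> t = 1)\<close> by blast
  qed
qed

end
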